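(* Let $0\le a<b$, $J=[a,b]$, $J'=(a,b]$, let $\varphi\in C^{1}(J,\mathbb{R})$ be an increasing function with $\varphi'(t)\neq 0$ for all $t\in J$, let $1<\mu<2$, $0\le\nu\le 1$, $\xi=\mu+\nu(2-\mu)$, and let $h:J'\to\mathbb{R}$ be a continuous function. Let $m\ge 1$, $\delta_i>0$ and $\lambda_i\in\mathbb{R}$ for $i=1,\dots,m$, and $a\le\tau_1<\tau_2<\cdots<\tau_m\le b$, be such that $$\Lambda:=\frac{(\varphi(b)-\varphi(a))^{\xi-1}}{\Gamma(\xi)}-\sum_{i=1}^{m}\frac{\lambda_i}{\Gamma(\xi+\delta_i)}(\varphi(\tau_i)-\varphi(a))^{\xi+\delta_i-1}\neq 0 .$$ Then the nonlocal boundary value problem $$ {}^{H}\mathcal{D}^{\mu,\nu;\varphi}_{a+}y(t)=h(t),\quad t\in J',\qquad y(a)=0,\qquad y(b)=\sum_{i=1}^{m}\lambda_i\,\mathcal{I}_{a+}^{\delta_i;\varphi}y(\tau_i)$$ is equivalent to the fractional integral equation $$y(t)=\frac{(\varphi(t)-\varphi(a))^{\xi-1}}{\Lambda\,\Gamma(\xi)}\left[\sum_{i=1}^{m}\lambda_i\,\mathcal{I}_{a+}^{\mu+\delta_i;\varphi}h(\tau_i)-\mathcal{I}_{a+}^{\mu;\varphi}h(b)\right]+\mathcal{I}_{a+}^{\mu;\varphi}h(t),\qquad t\in J,$$ that is, $y$ is a solution of the boundary value problem if and only if $y$ satisfies this integral equation.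
   Context: For $\alpha>0$ the $\varphi$-Riemann--Liouville fractional integral of a function $\mathfrak{h}$ is $$\mathcal{I}_{a+}^{\alpha;\varphi}\mathfrak{h}(t)=\frac{1}{\Gamma(\alpha)}\int_a^t\varphi'(s)(\varphi(t)-\varphi(s))^{\alpha-1}\mathfrak{h}(s)\,ds,$$ with $\mathcal{I}_{a+}^{0;\varphi}$ the identity; $\mathcal{I}_{a+}^{\alpha;\varphi}\mathfrak{h}(\tau)$ denotes its value at $t=\tau$. For $n-1<\mu<n$, $n\in\mathbb{N}$ (here $n=2$) and $0\le\nu\le 1$, the $\varphi$-Hilfer fractional derivative of order $\mu$ and type $\nu$ is $${}^{H}\mathcal{D}_{a+}^{\mu,\nu;\varphi}\mathfrak{h}(t)=\mathcal{I}_{a+}^{\nu(n-\mu);\varphi}\left(\frac{1}{\varphi'(t)}\frac{d}{dt}\right)^{n}\mathcal{I}_{a+}^{(1-\nu)(n-\mu);\varphi}\mathfrak{h}(t),$$ for functions for which the right-hand side is defined. The value $y(a)$ is understood as $\lim_{t\to a+}y(t)$ when $y$ is given on $(a,b]$. $\Gamma$ is the Gamma function.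
   Formalization: Adds that I^{μ;φ}h exists on J and that I^{1-ν(2-μ);φ}h(t)→0 as t→a+ (false otherwise: φ=id, a=0, ν>0, h=t^{ν(2-μ)-1}); y ranges over functions whose Hilfer derivative exists on J', and solutions are continuous on J. *)

theory Defs
  imports "HOL-Analysis.Analysis"
begin

text \<open>
  Functions on an interval are total functions \<open>real \<Rightarrow> real\<close> of which only the values on that
  interval matter.  The argument \<open>\<phi>'\<close> is the derivative of \<open>\<phi>\<close> on the closed interval (one-sided at
  the end points); the theorem assumes this.  Integrals are Lebesgue integrals, so the value of the
  integrand at \<open>a\<close> is irrelevant.
\<close>

definition phi_frac_integral ::
  "(real \<Rightarrow> real) \<Rightarrow> (real \<Rightarrow> real) \<Rightarrow> real \<Rightarrow> real \<Rightarrow> (real \<Rightarrow> real) \<Rightarrow> real \<Rightarrow> real" where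
  "phi_frac_integral \<phi> \<phi>' a \<alpha> f t =
     (if \<alpha> = 0 then f t
      else 1 / Gamma \<alpha> * (LINT s:{a..t}|lborel. \<phi>' s * (\<phi> t - \<phi> s) powr (\<alpha> - 1) * f s))"

text \<open>The fractional integral of \<open>f\<close> exists at \<open>t\<close>
  (the Lebesgue integral of a non-integrable function would silently be 0).\<close>

definition phi_frac_integral_exists ::
  "(real \<Rightarrow> real) \<Rightarrow> (real \<Rightarrow> real) \<Rightarrow> real \<Rightarrow> real \<Rightarrow> (real \<Rightarrow> real) \<Rightarrow> real \<Rightarrow> bool" where
  "phi_frac_integral_exists \<phi> \<phi>' a \<alpha> f t \<longleftrightarrow>
     \<alpha> = 0 \<or> set_integrable lborel {a..t} (\<lambda>s. \<phi>' s * (\<phi> t - \<phi> s) powr (\<alpha> - 1) * f s)"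

text \<open>The operator \<open>(1/\<phi>'(t)) d/dt\<close> on \<open>(a,b]\<close>; the derivative at \<open>b\<close> is the left derivative.\<close>

definition phi_deriv ::
  "(real \<Rightarrow> real) \<Rightarrow> real \<Rightarrow> real \<Rightarrow> (real \<Rightarrow> real) \<Rightarrow> real \<Rightarrow> real" where
  "phi_deriv \<phi>' a b f t = 1 / \<phi>' t * vector_derivative f (at t within {a<..b})"

definition phi_Hilfer_deriv ::
  "(real \<Rightarrow> real) \<Rightarrow> (real \<Rightarrow> real) \<Rightarrow> real \<Rightarrow> real \<Rightarrow> nat \<Rightarrow> real \<Rightarrow> real \<Rightarrow> (real \<Rightarrow> real) \<Rightarrow> real \<Rightarrow> real"
where
  "phi_Hilfer_deriv \<phi> \<phi>' a b n \<mu> \<nu> f =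
     phi_frac_integral \<phi> \<phi>' a (\<nu> * (real n - \<mu>))
       ((phi_deriv \<phi>' a b ^^ n)
         (phi_frac_integral \<phi> \<phi>' a ((1 - \<nu>) * (real n - \<mu>)) f))"

text \<open>Every operation in the preceding definition is meaningful at every point of \<open>(a,b]\<close>: the inner
  fractional integral exists, it is \<open>n\<close> times differentiable, and the outer fractional integral
  exists.\<close>

definition phi_Hilfer_deriv_exists ::
  "(real \<Rightarrow> real) \<Rightarrow> (real \<Rightarrow> real) \<Rightarrow> real \<Rightarrow> real \<Rightarrow> nat \<Rightarrow> real \<Rightarrow> real \<Rightarrow> (real \<Rightarrow> real) \<Rightarrow> bool"
where
  "phi_Hilfer_deriv_exists \<phi> \<phi>' a b n \<mu> \<nu> f \<longleftrightarrow>
     (let g = phi_frac_integral \<phi> \<phi>' a ((1 - \<nu>) * (real n - \<mu>)) f in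
       (\<forall>t\<in>{a<..b}. phi_frac_integral_exists \<phi> \<phi>' a ((1 - \<nu>) * (real n - \<mu>)) f t) \<and>
       (\<forall>k<n. \<forall>t\<in>{a<..b}. (phi_deriv \<phi>' a b ^^ k) g differentiable (at t within {a<..b})) \<and>
       (\<forall>t\<in>{a<..b}. phi_frac_integral_exists \<phi> \<phi>' a (\<nu> * (real n - \<mu>))
          ((phi_deriv \<phi>' a b ^^ n) g) t))"

text \<open>Solutions are continuous on \<open>[a,b]\<close>.  For a function given on \<open>(a,b]\<close> this means that it is
  continuous there and is extended to \<open>a\<close> by its limit, which is how \<open>y(a)\<close> is understood.\<close>

definition nonlocal_bvp_solution ::
  "(real \<Rightarrow> real) \<Rightarrow> (real \<Rightarrow> real) \<Rightarrow> real \<Rightarrow> real \<Rightarrow> real \<Rightarrow> real \<Rightarrow> (real \<Rightarrow> real) \<Rightarrow>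
   nat \<Rightarrow> (nat \<Rightarrow> real) \<Rightarrow> (nat \<Rightarrow> real) \<Rightarrow> (nat \<Rightarrow> real) \<Rightarrow> (real \<Rightarrow> real) \<Rightarrow> bool" where
  "nonlocal_bvp_solution \<phi> \<phi>' a b \<mu> \<nu> h m lam \<delta> \<tau> y \<longleftrightarrow>
     continuous_on {a..b} y \<and>
     phi_Hilfer_deriv_exists \<phi> \<phi>' a b 2 \<mu> \<nu> y \<and>
     (\<forall>t\<in>{a<..b}. phi_Hilfer_deriv \<phi> \<phi>' a b 2 \<mu> \<nu> y t = h t) \<and>
     y a = 0 \<and>
     y b = (\<Sum>i=1..m. lam i * phi_frac_integral \<phi> \<phi>' a (\<delta> i) y (\<tau> i))"

end

theory Submission
  imports Defs
begin

text \<open>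
  Write \<open>I\<^sup>\<alpha>\<close> for the fractional integral, \<open>D = (1/\<phi>') d/dt\<close>, \<open>\<beta> = (1 - \<nu>)(2 - \<mu>)\<close> and
  \<open>\<gamma> = \<nu>(2 - \<mu>)\<close>, so that \<open>\<xi> = \<mu> + \<gamma> = 2 - \<beta>\<close>.  By the Beta integral and Fubini, \<open>I\<^sup>\<alpha> I\<^sup>\<beta> = I\<^sup>\<alpha>\<^sup>+\<^sup>\<beta>\<close>.

  If \<open>y\<close> is a solution, \<open>f = D\<^sup>2 I\<^sup>\<beta> y\<close> is integrable.  Integrating twice and using \<open>y(a) = 0\<close> gives
  \<open>I\<^sup>\<beta> y = c (\<phi> - \<phi>(a)) + I\<^sup>2 f\<close>; applying \<open>I\<^sup>1\<^sup>-\<^sup>\<beta>\<close> and differentiating once,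
  \<open>y = c (\<phi> - \<phi>(a))\<^sup>\<xi>\<^sup>-\<^sup>1 / \<Gamma>(\<xi>) + I\<^sup>\<xi> f\<close> with \<open>I\<^sup>\<xi> f = I\<^sup>\<mu> I\<^sup>\<gamma> f = I\<^sup>\<mu> h\<close>.  The boundary condition
  at \<open>b\<close> then determines \<open>c\<close> because \<open>\<Lambda> \<noteq> 0\<close>.

  Conversely, for such a \<open>y\<close> one has \<open>D I\<^sup>\<beta> y = c + w\<close> with \<open>w = I\<^sup>1\<^sup>-\<^sup>\<gamma> h\<close>.  Since \<open>w(a+) = 0\<close>, \<open>f = D w\<close>
  satisfies \<open>w = I\<^sup>1 f\<close>, hence \<open>I\<^sup>1\<^sup>+\<^sup>\<gamma> f = I\<^sup>\<gamma> w = I\<^sup>1 h\<close>.  To conclude \<open>I\<^sup>\<gamma> f = h\<close> at every point, and not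
  merely almost everywhere, one needs that the left difference quotients of \<open>I\<^sup>1\<^sup>+\<^sup>\<gamma> f\<close> at \<open>t\<close> tend to
  \<open>I\<^sup>\<gamma> f(t)\<close> as soon as the latter integral converges absolutely.
\<close>

subsection \<open>The power kernel\<close>

lemma Gamma_real_neq_0: "0 < (x::real) \<Longrightarrow> Gamma x \<noteq> 0"
  by (metis Gamma_real_pos less_irrefl)

text \<open>Normalised by the Gamma function, these kernels form a convolution semigroup on the half
  line. Extension by zero encodes the upper limit of integration, so all integrals can run over one
  fixed interval.\<close>

definition power_kernel :: "real \<Rightarrow> real \<Rightarrow> real" where
  "power_kernel \<alpha> x = (if 0 < x then x powr (\<alpha> - 1) / Gamma \<alpha> else 0)"

lemma power_kernel_nonpos [simp]: "x \<le> 0 \<Longrightarrow> power_kernel \<alpha> x = 0"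
  by (simp add: power_kernel_def)

lemma power_kernel_nonneg: "0 < \<alpha> \<Longrightarrow> 0 \<le> power_kernel \<alpha> x"
  by (simp add: power_kernel_def Gamma_real_pos less_imp_le)

lemma power_kernel_one: "0 < x \<Longrightarrow> power_kernel 1 x = 1"
  by (simp add: power_kernel_def)

lemma power_kernel_two: "0 \<le> x \<Longrightarrow> power_kernel 2 x = x"
  using Gamma_fact[of 1, where 'a = real] by (simp add: power_kernel_def)

lemma power_kernel_eq_powr: "0 \<le> x \<Longrightarrow> power_kernel \<alpha> x = x powr (\<alpha> - 1) / Gamma \<alpha>"
  by (simp add: power_kernel_def)

lemma borel_measurable_power_kernel [measurable]: "power_kernel \<alpha> \<in> borel_measurable borel"
  unfolding power_kernel_def[abs_def] by measurable

lemma power_kernel_bounded: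
  assumes "1 \<le> \<alpha>" "x \<le> C"
  shows "power_kernel \<alpha> x \<le> \<bar>C\<bar> powr (\<alpha> - 1) / Gamma \<alpha>"
  using assms by (auto simp: power_kernel_def Gamma_real_pos intro!: divide_right_mono powr_mono2)

lemma isCont_power_kernel:
  assumes "0 < \<alpha>" "x \<noteq> 0"
  shows "isCont (power_kernel \<alpha>) x"
proof (cases "0 < x")
  case True
  have "isCont (\<lambda>x. x powr (\<alpha> - 1) / Gamma \<alpha>) x"
    using True assms by (auto intro!: continuous_intros simp: Gamma_real_neq_0)
  moreover have "\<forall>\<^sub>F z in nhds x. power_kernel \<alpha> z = z powr (\<alpha> - 1) / Gamma \<alpha>"
    using eventually_nhds_in_open[of "{0<..}" x] True
    by (auto elim!: eventually_mono simp: power_kernel_def)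
  ultimately show ?thesis by (simp add: isCont_cong)
next
  case False
  then have "\<forall>\<^sub>F z in nhds x. z < 0"
    using eventually_nhds_in_open[of "{..<0}" x] assms by auto
  then have "\<forall>\<^sub>F z in nhds x. power_kernel \<alpha> z = 0"
    by eventually_elim simp
  then show ?thesis by (simp add: isCont_cong)
qed

lemma continuous_on_power_kernel:
  assumes "1 < \<alpha>"
  shows "continuous_on UNIV (power_kernel \<alpha>)"
proof -
  \<comment> \<open>Since \<open>0 powr x = 0\<close>, clamping at zero absorbs the case
    distinction; the positive exponent then gives continuity at 0.\<close>
  have "power_kernel \<alpha> = (\<lambda>x. (max 0 x) powr (\<alpha> - 1) / Gamma \<alpha>)"
    by (auto simp: power_kernel_def fun_eq_iff max_def)
  moreover have "continuous_on UNIV (\<lambda>x. (max 0 x) powr (\<alpha> - 1) / Gamma \<alpha>)"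
    using assms by (intro continuous_intros continuous_on_powr')
      (auto simp: Gamma_real_neq_0)
  ultimately show ?thesis by simp
qed

lemma power_kernel_has_derivative:
  assumes "0 < \<gamma>" "0 < x"
  shows "(power_kernel (1 + \<gamma>) has_real_derivative power_kernel \<gamma> x) (at x)"
proof -
  have G: "Gamma (1 + \<gamma>) = \<gamma> * Gamma \<gamma>"
    using assms by (metis Gamma_plus1 add.commute nonpos_Ints_nonpos not_le)
  have "((\<lambda>x. x powr \<gamma> / (\<gamma> * Gamma \<gamma>)) has_real_derivative \<gamma> * x powr (\<gamma> - 1) / (\<gamma> * Gamma \<gamma>)) (at x)"
    using assms by (auto intro!: derivative_eq_intros simp: Gamma_real_neq_0)
  moreover have "\<forall>\<^sub>F z in nhds x. power_kernel (1 + \<gamma>) z = z powr \<gamma> / (\<gamma> * Gamma \<gamma>)"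
    using eventually_nhds_in_open[of "{0<..}" x] assms
    by (auto elim!: eventually_mono simp: power_kernel_def G)
  moreover have "power_kernel \<gamma> x = \<gamma> * x powr (\<gamma> - 1) / (\<gamma> * Gamma \<gamma>)"
    using assms by (simp add: power_kernel_def)
  ultimately show ?thesis
    by (metis DERIV_cong_ev)
qed

text \<open>The bound is uniform in \<open>e\<close> and reaches down to \<open>x = 0\<close>; it is what permits dominated
  convergence against an integrand that is only known to be absolutely integrable.\<close>
lemma power_kernel_diff_quotient_bound:
  assumes "0 < \<gamma>" "\<gamma> \<le> 1" "0 < e"
  shows "\<bar>power_kernel (1 + \<gamma>) x - power_kernel (1 + \<gamma>) (x - e)\<bar> / e \<le> power_kernel \<gamma> x / \<gamma>"
proof (cases "0 < x")
  case False
  then show ?thesis using assms by simp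
next
  case True
  have G: "Gamma (1 + \<gamma>) = \<gamma> * Gamma \<gamma>" and G0: "Gamma \<gamma> > 0"
    using assms by (metis Gamma_plus1 add.commute nonpos_Ints_nonpos not_le) (simp add: Gamma_real_pos assms)
  have px: "x powr \<gamma> = x * x powr (\<gamma> - 1)"
    using True by (simp add: powr_diff)
  have p: "0 < x powr (\<gamma> - 1)" using True by simp
  have "0 \<le> x powr \<gamma> - (if 0 < x - e then (x - e) powr \<gamma> else 0) \<and>
      x powr \<gamma> - (if 0 < x - e then (x - e) powr \<gamma> else 0) \<le> e * x powr (\<gamma> - 1)"
  proof (cases "0 < x - e")
    case xe: True
    \<comment> \<open>The exponent \<gamma> - 1 is not positive, so the power at x - e is at least
      the power at x. A mean value argument would instead produce the kernel at an intermediate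
      point, where it may be larger.\<close>
    have "(x - e) * x powr (\<gamma> - 1) \<le> (x - e) * (x - e) powr (\<gamma> - 1)"
      using xe assms True by (intro mult_left_mono powr_mono2') auto
    also have "\<dots> = (x - e) powr \<gamma>"
      using xe by (simp add: powr_diff)
    finally have "x powr \<gamma> - (x - e) powr \<gamma> \<le> e * x powr (\<gamma> - 1)"
      by (simp add: px algebra_simps)
    moreover have "(x - e) powr \<gamma> \<le> x powr \<gamma>"
      using xe assms by (intro powr_mono2) auto
    ultimately show ?thesis using xe by simp
  next
    \<comment> \<open>The shifted term vanishes, and x \<le> e bounds
      \<open>x powr \<gamma> = x * x powr (\<gamma> - 1)\<close> directly.\<close>
    case xe: False
    have "x * x powr (\<gamma> - 1) \<le> e * x powr (\<gamma> - 1)"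
      using xe p by (intro mult_right_mono) auto
    then show ?thesis using xe px by (metis diff_zero powr_ge_zero)
  qed
  then have "\<bar>x powr \<gamma> - (if 0 < x - e then (x - e) powr \<gamma> else 0)\<bar> / e \<le> x powr (\<gamma> - 1)"
    using assms by (simp add: field_simps split del: if_split)
  then have "\<bar>x powr \<gamma> - (if 0 < x - e then (x - e) powr \<gamma> else 0)\<bar> / e / (\<gamma> * Gamma \<gamma>)
      \<le> x powr (\<gamma> - 1) / (\<gamma> * Gamma \<gamma>)"
    using assms G0 by (intro divide_right_mono) auto
  moreover have "power_kernel (1 + \<gamma>) x - power_kernel (1 + \<gamma>) (x - e)
      = (x powr \<gamma> - (if 0 < x - e then (x - e) powr \<gamma> else 0)) / (\<gamma> * Gamma \<gamma>)"
    using True by (simp add: power_kernel_def G diff_divide_distrib)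
  moreover have "0 < \<gamma> * Gamma \<gamma>" using assms G0 by simp
  ultimately show ?thesis
    using True by (simp add: power_kernel_def abs_div_pos[symmetric] mult.commute mult.left_commute)
qed

subsection \<open>Fractional integrals with respect to \<open>\<phi>\<close>\<close>

locale phi_interval =
  fixes a b :: real and \<phi> \<phi>' :: "real \<Rightarrow> real"
  assumes a_less_b: "a < b"
    and phi_deriv: "\<And>t. t \<in> {a..b} \<Longrightarrow> (\<phi> has_real_derivative \<phi>' t) (at t within {a..b})"
    and cont_phi': "continuous_on {a..b} \<phi>'"
    and phi'_pos: "\<And>t. t \<in> {a..b} \<Longrightarrow> 0 < \<phi>' t"
begin

section \<open>Monotonicity of \<phi> and the measure with density \<phi>'\<close>

lemma phi_strict: "\<lbrakk>s \<in> {a..b}; t \<in> {a..b}; s < t\<rbrakk> \<Longrightarrow> \<phi> s < \<phi> t"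
proof -
  assume st: "s \<in> {a..b}" "t \<in> {a..b}" "s < t"
  obtain z where "s < z" "z < t" "\<phi> t - \<phi> s = (t - s) * \<phi>' z"
  proof -
    have "(\<phi> has_derivative (\<lambda>h. h * \<phi>' x)) (at x within {s..t})" if "s \<le> x" "x \<le> t" for x
    proof -
      have "(\<phi> has_real_derivative \<phi>' x) (at x within {s..t})"
        using st that by (intro has_field_derivative_subset[OF phi_deriv]) auto
      moreover have "(*) (\<phi>' x) = (\<lambda>h. h * \<phi>' x)"
        by (simp add: fun_eq_iff)
      ultimately show ?thesis
        by (simp only: has_field_derivative_def)
    qed
    from mvt_simple[OF st(3) this] show ?thesis by (auto intro: that)
  qed
  then show ?thesis using phi'_pos[of z] st
    by (smt (verit, best) atLeastAtMost_iff mult_pos_pos)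
qed

lemma phi_less_iff: "\<lbrakk>s \<in> {a..b}; t \<in> {a..b}\<rbrakk> \<Longrightarrow> \<phi> s < \<phi> t \<longleftrightarrow> s < t"
  by (metis linorder_cases order.asym phi_strict order.irrefl)

lemma phi_le_iff: "\<lbrakk>s \<in> {a..b}; t \<in> {a..b}\<rbrakk> \<Longrightarrow> \<phi> s \<le> \<phi> t \<longleftrightarrow> s \<le> t"
  by (metis linorder_not_less phi_less_iff)

lemma cont_phi: "continuous_on {a..b} \<phi>"
  by (rule DERIV_continuous_on[OF phi_deriv])

text \<open>Absorbing the weight \<phi>' into a finite measure makes every fractional integral an
  ordinary integral against a kernel, ready for Fubini and dominated convergence. Restriction comes
  first because \<phi>' is controlled only on [a,b].\<close>

definition M :: "real measure" where
  "M = density (restrict_space lborel {a..b}) (\<lambda>s. ennreal (\<phi>' s))"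

lemma space_M [simp]: "space M = {a..b}"
  by (simp add: M_def space_restrict_space)

lemma sets_M [measurable_cong]: "sets M = sets (restrict_space borel {a..b})"
  by (simp add: M_def sets_restrict_space)

lemma borel_measurable_M_iff: "f \<in> borel_measurable M \<longleftrightarrow> f \<in> borel_measurable (restrict_space borel {a..b})"
  by (rule arg_cong[where f = "\<lambda>A. f \<in> A"], rule measurable_cong_sets[OF sets_M refl])

lemma measurable_phi [measurable]: "\<phi> \<in> borel_measurable M"
  unfolding borel_measurable_M_iff by (rule borel_measurable_continuous_on_restrict[OF cont_phi])

lemma measurable_phi' [measurable]: "\<phi>' \<in> borel_measurable M"
  unfolding borel_measurable_M_iff by (rule borel_measurable_continuous_on_restrict[OF cont_phi'])

lemma integrable_M_iff: "integrable M f \<longleftrightarrow> set_integrable lborel {a..b} (\<lambda>s. \<phi>' s * f s)"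
  (is "?L \<longleftrightarrow> ?R") for f :: "real \<Rightarrow> real"
proof -
  have *: "?L \<longleftrightarrow> ?R" if f: "f \<in> borel_measurable M"
    unfolding M_def using f
    by (subst integrable_density)
      (auto simp: set_integrable_def integrable_restrict_space borel_measurable_M_iff
         measurable_phi'[unfolded borel_measurable_M_iff] AE_restrict_space_iff phi'_pos less_imp_le
         cong: measurable_cong_sets sets_restrict_space_cong intro!: AE_I2)
  have "f \<in> borel_measurable M" if ?R
  proof -
    have "(\<lambda>s. indicator {a..b} s *\<^sub>R (\<phi>' s * f s)) \<in> borel_measurable borel"
      using that by (auto simp: set_integrable_def dest: borel_measurable_integrable)
    \<comment> \<open>Dividing by \<phi>', which is positive on [a,b], recovers measurability of f,
      so the equivalence covers arbitrary f.\<close>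
    then have "(\<lambda>s. (indicator {a..b} s *\<^sub>R (\<phi>' s * f s)) / \<phi>' s) \<in> borel_measurable M"
      by (intro borel_measurable_divide measurable_phi')
        (auto simp: borel_measurable_M_iff intro: measurable_restrict_space1)
    also have "?this \<longleftrightarrow> f \<in> borel_measurable M"
      using phi'_pos by (intro measurable_cong) (auto simp: less_le)
    finally show ?thesis .
  qed
  then show ?thesis using * by (blast dest: borel_measurable_integrable)
qed

lemma integral_M: "integral\<^sup>L M f = (LINT s:{a..b}|lborel. \<phi>' s * f s)" for f :: "real \<Rightarrow> real"
proof (cases "integrable M f")
  case True
  then have f: "f \<in> borel_measurable M" by simp
  show ?thesis
    unfolding M_def using f
    by (subst integral_density)
      (auto simp: set_lebesgue_integral_def integral_restrict_space borel_measurable_M_iff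
         measurable_phi'[unfolded borel_measurable_M_iff] AE_restrict_space_iff phi'_pos less_imp_le
         cong: measurable_cong_sets sets_restrict_space_cong intro!: AE_I2)
next
  \<comment> \<open>Both sides are then 0 by the convention for non-integrable functions.\<close>
  case False
  then show ?thesis
    using integrable_M_iff[of f]
    by (simp add: not_integrable_integral_eq set_lebesgue_integral_def set_integrable_def)
qed

lemma finite_measure_M: "finite_measure M"
proof -
  have "integrable M (\<lambda>_. 1 :: real)"
    unfolding integrable_M_iff by (simp add: borel_integrable_atLeastAtMost' cont_phi')
  then show ?thesis
    by (intro finite_measureI) (auto simp: integrable_iff_bounded)
qed

sublocale M: finite_measure M by (rule finite_measure_M)

sublocale MM: pair_sigma_finite M M ..

text \<open>The measure has no atoms, so the endpoint a and the singular point of a kernel can be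
  discarded.\<close>

lemma AE_M_neq: "AE s in M. s \<noteq> t"
proof -
  have "AE s in lborel. s \<noteq> t" by (rule AE_lborel_singleton)
  then show ?thesis
    unfolding M_def
    by (subst AE_density)
      (auto simp: AE_restrict_space_iff borel_measurable_M_iff[symmetric]
        measurable_phi'[unfolded borel_measurable_M_iff]
         cong: measurable_cong_sets sets_restrict_space_cong )
qed

text \<open>As the kernel vanishes on the nonpositive numbers, the integral over all of \<open>[a,b]\<close> is
  really one over \<open>[a,t)\<close>.\<close>
definition RL :: "real \<Rightarrow> (real \<Rightarrow> real) \<Rightarrow> real \<Rightarrow> real" where
  "RL \<alpha> f t = (\<integral>s. power_kernel \<alpha> (\<phi> t - \<phi> s) * f s \<partial>M)"

abbreviation RL_exists :: "real \<Rightarrow> (real \<Rightarrow> real) \<Rightarrow> real \<Rightarrow> bool" where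
  "RL_exists \<alpha> f t \<equiv> integrable M (\<lambda>s. power_kernel \<alpha> (\<phi> t - \<phi> s) * f s)"

text \<open>At s = t the two sides agree because \<open>0 powr x = 0\<close>, matching the value of
  the kernel at 0; for s > t the kernel itself does the truncation.\<close>

lemma kernel_indicator:
  assumes "0 < \<alpha>" "t \<in> {a..b}"
  shows "indicator {a..t} s *\<^sub>R (\<phi>' s * (\<phi> t - \<phi> s) powr (\<alpha> - 1) * f s)
    = Gamma \<alpha> * (indicator {a..b} s *\<^sub>R (\<phi>' s * (power_kernel \<alpha> (\<phi> t - \<phi> s) * f s)))"
  using assms phi_le_iff[of t s] Gamma_real_neq_0[of \<alpha>]
  by (auto simp: indicator_def power_kernel_def phi_less_iff)

lemma phi_frac_integral_exists_iff:
  assumes "0 < \<alpha>" "t \<in> {a..b}"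
  shows "phi_frac_integral_exists \<phi> \<phi>' a \<alpha> f t \<longleftrightarrow> RL_exists \<alpha> f t"
  using assms Gamma_real_neq_0[of \<alpha>]
  by (simp add: phi_frac_integral_exists_def integrable_M_iff set_integrable_def kernel_indicator
      del: real_scaleR_def mult_scaleR_right)

lemma phi_frac_integral_eq:
  assumes "0 < \<alpha>" "t \<in> {a..b}"
  shows "phi_frac_integral \<phi> \<phi>' a \<alpha> f t = RL \<alpha> f t"
  using assms Gamma_real_neq_0[of \<alpha>]
  by (simp add: phi_frac_integral_def RL_def integral_M set_lebesgue_integral_def kernel_indicator
      del: real_scaleR_def mult_scaleR_right)

subsection \<open>The semigroup property\<close>

text \<open>The substitution u = (\<phi>(s) - \<phi>(r)) / (\<phi>(t) - \<phi>(r)) leads to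
  \<open>Beta \<beta> \<alpha>\<close>, whose Gamma quotient cancels the normalisations. Outside
  [r,t] one of the factors vanishes; for r \<ge> t this happens everywhere.\<close>

lemma kernel_beta:
  assumes "0 < \<alpha>" "0 < \<beta>" and r: "r \<in> {a..b}" and t: "t \<in> {a..b}"
  shows "has_bochner_integral M (\<lambda>s. power_kernel \<alpha> (\<phi> t - \<phi> s) * power_kernel \<beta> (\<phi> s - \<phi> r))
    (power_kernel (\<alpha> + \<beta>) (\<phi> t - \<phi> r))"
    (is "has_bochner_integral M ?k _")
proof (cases "r < t")
  case False
  have "has_bochner_integral M (\<lambda>s. 0) (0 :: real)" by (rule has_bochner_integral_zero)
  also have "?this \<longleftrightarrow> has_bochner_integral M ?k 0"
  proof (rule has_bochner_integral_cong)
    fix s assume "s \<in> space M"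
    then show "0 = power_kernel \<alpha> (\<phi> t - \<phi> s) * power_kernel \<beta> (\<phi> s - \<phi> r)"
      using False r t phi_le_iff[of t s] phi_le_iff[of s r] by (cases "t \<le> s") auto
  qed auto
  finally show ?thesis using False r t phi_le_iff[of t r] by simp
next
  case True
  define L where "L = \<phi> t - \<phi> r"
  have L: "0 < L" using phi_strict[OF r t True] by (simp add: L_def)
  define g where "g s = (\<phi> s - \<phi> r) / L" for s
  define f :: "real \<Rightarrow> real" where "f u = u powr (\<beta> - 1) * (1 - u) powr (\<alpha> - 1)" for u
  have inj: "inj_on g {r..t}"
  proof (rule inj_onI)
    fix x y assume xy: "x \<in> {r..t}" "y \<in> {r..t}" "g x = g y"
    then have "\<phi> x = \<phi> y" using L by (simp add: g_def)
    then show "x = y"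
      using xy r t phi_less_iff[of x y] phi_less_iff[of y x] by auto
  qed
  have img: "g ` {r..t} = {0..1}"
  proof (rule antisym)
    show "g ` {r..t} \<subseteq> {0..1}"
      using L r t by (auto simp: g_def L_def divide_simps phi_le_iff)
    have "continuous_on {r..t} g"
      unfolding g_def using L r t
      by (intro continuous_intros continuous_on_subset[OF cont_phi]) auto
    then have "\<exists>x. r \<le> x \<and> x \<le> t \<and> g x = u" if "u \<in> {0..1}" for u
      using that True L by (intro IVT') (auto simp: g_def L_def)
    then show "{0..1} \<subseteq> g ` {r..t}" by force
  qed
  have der: "(g has_field_derivative \<phi>' s / L) (at s within {r..t})" if "s \<in> {r..t}" for s
  proof -
    have "(\<phi> has_real_derivative \<phi>' s) (at s within {r..t})"
      using that r t by (intro has_field_derivative_subset[OF phi_deriv]) auto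
    then show ?thesis unfolding g_def using L by (auto intro!: derivative_eq_intros)
  qed
  have "f absolutely_integrable_on {0..1} \<and> integral {0..1} f = Beta \<beta> \<alpha>"
  proof
    show "f absolutely_integrable_on {0..1}"
      using integrable_Beta[of \<beta> \<alpha>] assms
      by (auto simp: f_def[abs_def] set_integrable_def intro!: integrable_completion[THEN iffD2])
    show "integral {0..1} f = Beta \<beta> \<alpha>"
      using has_integral_Beta_real[of \<beta> \<alpha>] assms by (simp add: f_def[abs_def] integral_unique)
  qed
  then have ch: "(\<lambda>s. \<bar>\<phi>' s / L\<bar> * f (g s)) absolutely_integrable_on {r..t}"
      "integral {r..t} (\<lambda>s. \<bar>\<phi>' s / L\<bar> * f (g s)) = Beta \<beta> \<alpha>"
    using has_absolute_integral_change_of_variables_1'[of "{r..t}" g "\<lambda>s. \<phi>' s / L" f "Beta \<beta> \<alpha>"] der inj img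
    by auto
  \<comment> \<open>The exponent of L collects the scaling of both kernels and one factor from the
    change of variables: (\<alpha> - 1) + (\<beta> - 1) + 1.\<close>
  define C where "C = L powr (\<alpha> + \<beta> - 1) / (Gamma \<alpha> * Gamma \<beta>)"
  have eq: "indicator {a..b} s *\<^sub>R (\<phi>' s * ?k s)
      = C * (indicator {r..t} s *\<^sub>R (\<bar>\<phi>' s / L\<bar> * f (g s)))" for s
  proof (cases "s \<in> {r..t}")
    case True
    then have s: "s \<in> {a..b}" using r t by auto
    then have "\<phi> r \<le> \<phi> s" "\<phi> s \<le> \<phi> t" using True r t by (auto simp: phi_le_iff)
    moreover have "f (g s) = (\<phi> s - \<phi> r) powr (\<beta> - 1) * (\<phi> t - \<phi> s) powr (\<alpha> - 1) / L powr (\<alpha> + \<beta> - 2)"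
    proof -
      have "1 - g s = (\<phi> t - \<phi> s) / L" using L by (simp add: g_def L_def field_simps)
      then have "f (g s) = (\<phi> s - \<phi> r) powr (\<beta> - 1) / L powr (\<beta> - 1) * ((\<phi> t - \<phi> s) powr (\<alpha> - 1) / L powr (\<alpha> - 1))"
        using L calculation by (simp add: f_def g_def powr_divide)
      also have "\<dots> = (\<phi> s - \<phi> r) powr (\<beta> - 1) * (\<phi> t - \<phi> s) powr (\<alpha> - 1) / (L powr (\<beta> - 1) * L powr (\<alpha> - 1))"
        by simp
      also have "L powr (\<beta> - 1) * L powr (\<alpha> - 1) = L powr (\<alpha> + \<beta> - 2)"
        by (simp flip: powr_add add: algebra_simps)
      finally show ?thesis .
    qed
    moreover have "L powr (\<alpha> + \<beta> - 1) = L * L powr (\<alpha> + \<beta> - 2)"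
      using L powr_add[of L 1 "\<alpha> + \<beta> - 2"] by simp
    ultimately show ?thesis
      using True s L phi'_pos[OF s] by (simp add: C_def power_kernel_eq_powr abs_div_pos)
  next
    case False
    then show ?thesis
      using r t phi_le_iff[of t s] phi_le_iff[of s r] by (cases "s < r") (auto simp: indicator_def)
  qed
  have meas: "?k \<in> borel_measurable M" by measurable
  have meas': "(\<lambda>s. indicator {a..b} s *\<^sub>R (\<phi>' s * ?k s)) \<in> borel_measurable lborel"
  proof -
    have "(\<lambda>s. \<phi>' s * ?k s) \<in> borel_measurable M" by measurable
    then show ?thesis
      by (subst (asm) borel_measurable_M_iff, subst (asm) borel_measurable_restrict_space_iff) (auto simp: mult.commute)
  qed
  \<comment> \<open>The change of variables lives on the completed Lebesgue measure; Borel
    measurability of the integrand transfers integrability and value back to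
    \<open>lborel\<close>.\<close>
  have lint: "integrable lebesgue (\<lambda>s. indicator {a..b} s *\<^sub>R (\<phi>' s * ?k s))"
    using ch(1) unfolding set_integrable_def eq by (rule integrable_mult_right)
  then have int: "integrable M ?k"
    unfolding integrable_M_iff set_integrable_def using meas' by (simp add: integrable_completion)
  have "integral\<^sup>L M ?k = integral\<^sup>L lebesgue (\<lambda>s. indicator {a..b} s *\<^sub>R (\<phi>' s * ?k s))"
    unfolding integral_M set_lebesgue_integral_def using meas' by (simp add: integral_completion)
  also have "\<dots> = C * (LINT s:{r..t}|lebesgue. \<bar>\<phi>' s / L\<bar> * f (g s))"
    by (subst eq) (simp add: set_lebesgue_integral_def)
  also have "(LINT s:{r..t}|lebesgue. \<bar>\<phi>' s / L\<bar> * f (g s)) = Beta \<beta> \<alpha>"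
    by (rule trans[OF set_lebesgue_integral_eq_integral(2)[OF ch(1)] ch(2)])
  also have "C * Beta \<beta> \<alpha> = power_kernel (\<alpha> + \<beta>) L"
    using L assms Gamma_real_neq_0[of \<alpha>] Gamma_real_neq_0[of \<beta>]
    by (simp add: C_def power_kernel_def Beta_def add.commute)
  finally show ?thesis using int by (simp add: has_bochner_integral_iff L_def)
qed

text \<open>The constant 1 is almost everywhere the kernel of order 1 based at a, so this is
  \<open>kernel_beta\<close> with \<beta> = 1.\<close>

lemma integrable_kernel:
  assumes "0 < \<alpha>" "t \<in> {a..b}"
  shows "integrable M (\<lambda>s. power_kernel \<alpha> (\<phi> t - \<phi> s))"
    and "(\<integral>s. power_kernel \<alpha> (\<phi> t - \<phi> s) \<partial>M) = power_kernel (\<alpha> + 1) (\<phi> t - \<phi> a)"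
proof -
  have "AE s in M. power_kernel \<alpha> (\<phi> t - \<phi> s) * power_kernel 1 (\<phi> s - \<phi> a) = power_kernel \<alpha> (\<phi> t - \<phi> s)"
    using AE_M_neq[of a] AE_space
    by eventually_elim (use a_less_b phi_strict[of a] in \<open>auto simp: power_kernel_one\<close>)
  then have "has_bochner_integral M (\<lambda>s. power_kernel \<alpha> (\<phi> t - \<phi> s)) (power_kernel (\<alpha> + 1) (\<phi> t - \<phi> a))"
    using kernel_beta[of \<alpha> 1 a t] assms a_less_b
    by (subst has_bochner_integral_cong_AE[where g = "\<lambda>s. power_kernel \<alpha> (\<phi> t - \<phi> s) * power_kernel 1 (\<phi> s - \<phi> a)"])
      (auto elim!: eventually_mono)
  then show "integrable M (\<lambda>s. power_kernel \<alpha> (\<phi> t - \<phi> s))"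
    "(\<integral>s. power_kernel \<alpha> (\<phi> t - \<phi> s) \<partial>M) = power_kernel (\<alpha> + 1) (\<phi> t - \<phi> a)"
    by (auto simp: has_bochner_integral_iff)
qed

lemma RL_exists_bounded:
  assumes "0 < \<alpha>" "t \<in> {a..b}" and f: "f \<in> borel_measurable M" and B: "\<And>s. s \<in> {a..b} \<Longrightarrow> \<bar>f s\<bar> \<le> B"
  shows "RL_exists \<alpha> f t"
proof (rule Bochner_Integration.integrable_bound[of M "\<lambda>s. B * power_kernel \<alpha> (\<phi> t - \<phi> s)"])
  show "integrable M (\<lambda>s. B * power_kernel \<alpha> (\<phi> t - \<phi> s))"
    using integrable_kernel(1)[OF assms(1,2)] by simp
  show "(\<lambda>s. power_kernel \<alpha> (\<phi> t - \<phi> s) * f s) \<in> borel_measurable M"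
    using f by measurable
  have "norm (power_kernel \<alpha> (\<phi> t - \<phi> s) * f s) \<le> norm (B * power_kernel \<alpha> (\<phi> t - \<phi> s))"
    if "s \<in> {a..b}" for s
    using mult_right_mono[OF B[OF that] power_kernel_nonneg[OF assms(1), of "\<phi> t - \<phi> s"]] B[OF that]
      power_kernel_nonneg[OF assms(1), of "\<phi> t - \<phi> s"]
    by (simp add: abs_mult mult.commute)
  then show "AE s in M. norm (power_kernel \<alpha> (\<phi> t - \<phi> s) * f s) \<le> norm (B * power_kernel \<alpha> (\<phi> t - \<phi> s))"
    by (intro AE_I2) auto
qed

lemma RL_exists_continuous:
  assumes "0 < \<alpha>" "t \<in> {a..b}" and f: "continuous_on {a..b} f"
  shows "RL_exists \<alpha> f t"
proof -
  have "bounded (f ` {a..b})"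
    by (intro compact_imp_bounded compact_continuous_image f compact_Icc)
  then obtain B where "\<forall>x\<in>f ` {a..b}. norm x \<le> B"
    unfolding bounded_iff by blast
  then show ?thesis
    using assms by (intro RL_exists_bounded[where B = B])
      (auto simp: borel_measurable_M_iff borel_measurable_continuous_on_restrict)
qed

text \<open>From order 1 on the kernel has no singularity and stays bounded, so integrability of f
  carries over to the product.\<close>

lemma RL_exists_ge_1:
  assumes "1 \<le> \<alpha>" "t \<in> {a..b}" and f: "integrable M f"
  shows "RL_exists \<alpha> f t"
proof -
  let ?C = "\<bar>\<phi> t - \<phi> a\<bar> powr (\<alpha> - 1) / Gamma \<alpha>"
  have le: "power_kernel \<alpha> (\<phi> t - \<phi> s) \<le> ?C" if "s \<in> {a..b}" for s
    using that assms a_less_b by (intro power_kernel_bounded) (auto simp: phi_le_iff)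
  show ?thesis
  proof (rule Bochner_Integration.integrable_bound[of M "\<lambda>s. ?C * f s"])
    show "(\<lambda>s. power_kernel \<alpha> (\<phi> t - \<phi> s) * f s) \<in> borel_measurable M"
      using f by measurable
    have "norm (power_kernel \<alpha> (\<phi> t - \<phi> s) * f s) \<le> norm (?C * f s)" if "s \<in> {a..b}" for s
      using le[OF that] power_kernel_nonneg[of \<alpha> "\<phi> t - \<phi> s"] assms
      by (auto simp: abs_mult simp del: times_divide_eq_left intro!: mult_right_mono)
    then show "AE s in M. norm (power_kernel \<alpha> (\<phi> t - \<phi> s) * f s) \<le> norm (?C * f s)"
      by (intro AE_I2) auto
  qed (use f in simp)
qed

text \<open>\<open>kernel_beta\<close> evaluates the integral over s for fixed r, and since the
  kernels are nonnegative it does so for absolute values as well. Convergence of the combined order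
  at t thus gives joint integrability, and Fubini swaps the integrals.\<close>

lemma RL_RL:
  assumes "0 < \<alpha>" "0 < \<beta>" and t: "t \<in> {a..b}" and f[measurable]: "f \<in> borel_measurable M"
    and int: "RL_exists (\<alpha> + \<beta>) f t"
  shows "RL \<alpha> (RL \<beta> f) t = RL (\<alpha> + \<beta>) f t"
proof -
  define F where "F r s = power_kernel \<alpha> (\<phi> t - \<phi> s) * power_kernel \<beta> (\<phi> s - \<phi> r) * f r" for r s
  have inner: "has_bochner_integral M (F r) (power_kernel (\<alpha> + \<beta>) (\<phi> t - \<phi> r) * f r)" if "r \<in> {a..b}" for r
    unfolding F_def[abs_def] using kernel_beta[OF assms(1,2) that t] by (intro has_bochner_integral_mult_left)
  have norm: "(\<integral>s. norm (F r s) \<partial>M) = norm (power_kernel (\<alpha> + \<beta>) (\<phi> t - \<phi> r) * f r)" if "r \<in> {a..b}" for r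
  proof -
    have "norm (F r s) = power_kernel \<alpha> (\<phi> t - \<phi> s) * power_kernel \<beta> (\<phi> s - \<phi> r) * \<bar>f r\<bar>" for s
      using assms by (simp add: F_def abs_mult power_kernel_nonneg)
    then show ?thesis
      using has_bochner_integral_mult_left[OF kernel_beta[OF assms(1,2) that t], of "\<bar>f r\<bar>"]
        power_kernel_nonneg[of "\<alpha> + \<beta>" "\<phi> t - \<phi> r"] assms
      by (simp add: has_bochner_integral_iff abs_mult)
  qed
  have "integrable (M \<Otimes>\<^sub>M M) (case_prod F)"
  proof (rule MM.Fubini_integrable)
    show "case_prod F \<in> borel_measurable (M \<Otimes>\<^sub>M M)"
      unfolding F_def[abs_def] by measurable
    have "integrable M (\<lambda>r. norm (power_kernel (\<alpha> + \<beta>) (\<phi> t - \<phi> r) * f r))"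
      using int by (rule integrable_norm)
    then show "integrable M (\<lambda>r. \<integral>s. norm (case_prod F (r, s)) \<partial>M)"
      by (subst Bochner_Integration.integrable_cong[OF refl, where g = "\<lambda>r. norm (power_kernel (\<alpha> + \<beta>) (\<phi> t - \<phi> r) * f r)"])
        (auto simp: norm[unfolded real_norm_def])
    show "AE r in M. integrable M (\<lambda>s. case_prod F (r, s))"
      using inner by (intro AE_I2) (auto simp: has_bochner_integral_iff)
  qed
  from MM.Fubini_integral[OF this]
  have "(\<integral>s. (\<integral>r. F r s \<partial>M) \<partial>M) = (\<integral>r. (\<integral>s. F r s \<partial>M) \<partial>M)" .
  also have "(\<integral>s. (\<integral>r. F r s \<partial>M) \<partial>M) = RL \<alpha> (RL \<beta> f) t"
    by (simp add: RL_def F_def mult.assoc)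
  also have "(\<integral>r. (\<integral>s. F r s \<partial>M) \<partial>M) = RL (\<alpha> + \<beta>) f t"
    unfolding RL_def using inner
    by (intro Bochner_Integration.integral_cong) (auto simp: has_bochner_integral_iff)
  finally show ?thesis .
qed

lemma RL_kernel:
  assumes "0 < \<alpha>" "0 < \<beta>" "t \<in> {a..b}"
  shows "RL \<alpha> (\<lambda>s. power_kernel \<beta> (\<phi> s - \<phi> a)) t = power_kernel (\<alpha> + \<beta>) (\<phi> t - \<phi> a)"
  using kernel_beta[of \<alpha> \<beta> a t] assms a_less_b by (simp add: RL_def has_bochner_integral_iff)

lemma RL_at_a [simp]: "RL \<alpha> f a = 0"
proof -
  have "RL \<alpha> f a = integral\<^sup>L M (\<lambda>_. 0)"
    unfolding RL_def using a_less_b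
    by (intro Bochner_Integration.integral_cong refl) (auto simp: phi_le_iff)
  then show ?thesis by simp
qed

text \<open>The endpoint a is a null set, so identities known only on (a,b], such as the Hilfer
  equation, can be used under the integral.\<close>

lemma RL_cong:
  assumes "\<And>s. s \<in> {a<..b} \<Longrightarrow> f s = g s" "f \<in> borel_measurable M" "g \<in> borel_measurable M"
  shows "RL \<alpha> f t = RL \<alpha> g t"
  unfolding RL_def
proof (rule integral_cong_AE)
  show "AE s in M. power_kernel \<alpha> (\<phi> t - \<phi> s) * f s = power_kernel \<alpha> (\<phi> t - \<phi> s) * g s"
    using AE_M_neq[of a] AE_space by eventually_elim (use assms(1) in auto)
qed (use assms(2,3) in measurable)

lemma borel_measurable_RL [measurable]:
  assumes [measurable]: "f \<in> borel_measurable M"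
  shows "RL \<alpha> f \<in> borel_measurable M"
  unfolding RL_def[abs_def] by measurable

lemma RL_add:
  assumes "RL_exists \<alpha> f t" "RL_exists \<alpha> g t"
  shows "RL \<alpha> (\<lambda>s. f s + g s) t = RL \<alpha> f t + RL \<alpha> g t"
  using assms by (simp add: RL_def distrib_left)

lemma RL_cmult: "RL \<alpha> (\<lambda>s. c * f s) t = c * RL \<alpha> f t"
  by (simp add: RL_def mult.left_commute)

subsection \<open>Differentiation of fractional integrals\<close>

text \<open>Passing to the gauge integral makes the fundamental theorem of calculus
  available.\<close>

lemma RL_one:
  assumes F: "integrable M F" and t: "t \<in> {a..b}"
  shows "RL 1 F t = integral {a..t} (\<lambda>s. \<phi>' s * F s)"
proof -
  have "RL_exists 1 F t" using t F by (intro RL_exists_ge_1) auto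
  then have "RL 1 F t = integral {a..b} (\<lambda>s. \<phi>' s * (power_kernel 1 (\<phi> t - \<phi> s) * F s))"
    unfolding RL_def integral_M integrable_M_iff by (rule set_borel_integral_eq_integral(2))
  also have "\<dots> = integral {a..b} (\<lambda>s. if s \<in> {a..t} then \<phi>' s * F s else 0)"
  \<comment> \<open>The point t is excepted because the kernel of order 1 jumps at 0, where its
    value is 0.\<close>
  proof (rule integral_spike[of "{t}"])
    fix s assume "s \<in> {a..b} - {t}"
    then show "(if s \<in> {a..t} then \<phi>' s * F s else 0) = \<phi>' s * (power_kernel 1 (\<phi> t - \<phi> s) * F s)"
      using t phi_strict[of s t] phi_strict[of t s] by (auto simp: power_kernel_one)
  qed simp
  also have "\<dots> = integral {a..t} (\<lambda>s. \<phi>' s * F s)"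
    using t unfolding integral_restrict_Int by (simp add: min_def)
  finally show ?thesis .
qed

lemma integrable_on_M:
  assumes "integrable M F"
  shows "(\<lambda>s. \<phi>' s * F s) integrable_on {a..b}"
  using assms unfolding integrable_M_iff by (rule set_borel_integral_eq_integral(1))

lemma RL_one_diff:
  assumes F: "integrable M F" and st: "s \<in> {a..b}" "t \<in> {a..b}" "s \<le> t"
  shows "RL 1 F t - RL 1 F s = integral {s..t} (\<lambda>s. \<phi>' s * F s)"
proof -
  have "(\<lambda>s. \<phi>' s * F s) integrable_on {a..t}"
    using st by (intro integrable_on_subinterval[OF integrable_on_M[OF F]]) auto
  from Henstock_Kurzweil_Integration.integral_combine[OF _ st(3) this]
  show ?thesis using F st by (simp add: RL_one)
qed

lemma RL_one_has_derivative:
  assumes F: "integrable M F" "continuous_on {a<..b} F" and t: "t \<in> {a<..b}"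
  shows "(RL 1 F has_real_derivative \<phi>' t * F t) (at t within {a<..b})"
proof -
  \<comment> \<open>F may be singular at a, so the integral is differentiated from an interior base
    point; any point between a and t serves.\<close>
  define c where "c = (a + t) / 2"
  have c: "a < c" "c < t" using t by (auto simp: c_def)
  have "continuous_on {c..b} (\<lambda>s. \<phi>' s * F s)"
    using c by (intro continuous_intros continuous_on_subset[OF cont_phi'] continuous_on_subset[OF F(2)]) auto
  from integral_has_real_derivative[OF this, of t]
  have "((\<lambda>x. RL 1 F c + integral {c..x} (\<lambda>s. \<phi>' s * F s)) has_real_derivative \<phi>' t * F t) (at t within {c..b})"
    using c t by (auto intro!: derivative_eq_intros)
  then have "(RL 1 F has_real_derivative \<phi>' t * F t) (at t within {c..b})"
  proof (rule has_field_derivative_transform_within[OF _ zero_less_one])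
    fix x assume "x \<in> {c..b}"
    then show "RL 1 F c + integral {c..x} (\<lambda>s. \<phi>' s * F s) = RL 1 F x"
      using RL_one_diff[OF F(1), of c x] c by auto
  qed (use c t in auto)
  moreover have "at t within {c..b} = at t within {a<..b}"
    using c t by (intro at_within_nhd[of t "{c<..}"]) auto
  ultimately show ?thesis by simp
qed

text \<open>The fundamental theorem for the gauge integral covers discontinuous derivatives too. It
  is applied on [t,b] because G is not controlled at a, whence the constant
  \<open>G b - RL 1 F b\<close>.\<close>

lemma antiderivative_RL_one:
  assumes F: "integrable M F"
    and G: "\<And>t. t \<in> {a<..b} \<Longrightarrow> (G has_real_derivative \<phi>' t * F t) (at t within {a<..b})"
  shows "\<exists>c. \<forall>t\<in>{a<..b}. G t = c + RL 1 F t"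
proof (intro exI ballI)
  fix t assume t: "t \<in> {a<..b}"
  have "((\<lambda>s. \<phi>' s * F s) has_integral G b - G t) {t..b}"
  proof (rule fundamental_theorem_of_calculus)
    fix x assume "x \<in> {t..b}"
    then have "(G has_real_derivative \<phi>' x * F x) (at x within {t..b})"
      using t by (intro has_field_derivative_subset[OF G]) auto
    then show "(G has_vector_derivative \<phi>' x * F x) (at x within {t..b})"
      by (simp add: has_real_derivative_iff_has_vector_derivative)
  qed (use t in auto)
  then have "G b - G t = RL 1 F b - RL 1 F t"
    using RL_one_diff[OF F, of t b] t by (simp add: integral_unique)
  then show "G t = (G b - RL 1 F b) + RL 1 F t" by simp
qed

text \<open>Dominated convergence with a constant multiple of the absolute value of F. For order 1
  the kernel is discontinuous at 0, but this concerns only the null set s = x.\<close>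

lemma continuous_on_RL:
  assumes "1 \<le> \<alpha>" and F: "integrable M F"
  shows "continuous_on {a..b} (RL \<alpha> F)"
proof (rule continuous_on_sequentiallyI)
  fix u :: "nat \<Rightarrow> real" and x assume u: "\<forall>n. u n \<in> {a..b}" and x: "x \<in> {a..b}" and lim: "u \<longlonglongrightarrow> x"
  let ?C = "\<bar>\<phi> b - \<phi> a\<bar> powr (\<alpha> - 1) / Gamma \<alpha>"
  have phi: "(\<lambda>n. \<phi> (u n)) \<longlonglongrightarrow> \<phi> x"
    using continuous_on_tendsto_compose[OF cont_phi lim x] u by simp
  have le: "power_kernel \<alpha> (\<phi> t - \<phi> s) \<le> ?C" if "s \<in> {a..b}" "t \<in> {a..b}" for s t
    using that assms a_less_b phi_le_iff[of a s] phi_le_iff[of t b] by (intro power_kernel_bounded) auto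
  show "(\<lambda>n. RL \<alpha> F (u n)) \<longlonglongrightarrow> RL \<alpha> F x"
    unfolding RL_def
  proof (rule integral_dominated_convergence[where w = "\<lambda>s. ?C * \<bar>F s\<bar>"])
    show "(\<lambda>s. power_kernel \<alpha> (\<phi> x - \<phi> s) * F s) \<in> borel_measurable M"
      using F by measurable
    show "(\<lambda>s. power_kernel \<alpha> (\<phi> (u n) - \<phi> s) * F s) \<in> borel_measurable M" for n
      using F by measurable
    show "integrable M (\<lambda>s. ?C * \<bar>F s\<bar>)" using F by auto
    show "AE s in M. (\<lambda>n. power_kernel \<alpha> (\<phi> (u n) - \<phi> s) * F s) \<longlonglongrightarrow> power_kernel \<alpha> (\<phi> x - \<phi> s) * F s"
      using AE_M_neq[of x] AE_space
    proof eventually_elim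
      case (elim s)
      then have "\<phi> x - \<phi> s \<noteq> 0"
        using x phi_less_iff[of x s] phi_less_iff[of s x] by auto
      then have "isCont (power_kernel \<alpha>) (\<phi> x - \<phi> s)"
        using assms by (intro isCont_power_kernel) auto
      then show ?case
        by (intro tendsto_intros isCont_tendsto_compose[where g = "power_kernel \<alpha>"] phi)
    qed
    have "norm (power_kernel \<alpha> (\<phi> (u n) - \<phi> s) * F s) \<le> ?C * \<bar>F s\<bar>" if "s \<in> {a..b}" for n s
      using le[OF that, of "u n"] u power_kernel_nonneg[of \<alpha> "\<phi> (u n) - \<phi> s"] assms
      by (auto simp: abs_mult simp del: times_divide_eq_left intro!: mult_right_mono)
    then show "AE s in M. norm (power_kernel \<alpha> (\<phi> (u n) - \<phi> s) * F s) \<le> ?C * \<bar>F s\<bar>" for n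
      by (intro AE_I2) auto
  qed
qed

lemma RL_tendsto_0:
  assumes "1 \<le> \<alpha>" and F: "integrable M F"
  shows "(RL \<alpha> F \<longlongrightarrow> 0) (at_right a)"
proof -
  have "(RL \<alpha> F \<longlongrightarrow> RL \<alpha> F a) (at a within {a..b})"
    using continuous_on_RL[OF assms] a_less_b unfolding continuous_on by (metis atLeastAtMost_iff order.refl order.strict_implies_order)
  then show ?thesis
    using a_less_b by (simp add: at_within_Icc_at_right)
qed

text \<open>The fractional integral of order \<open>1 + \<gamma>\<close> need not be known to be differentiable at \<open>t\<close>,
  and the one of order \<open>\<gamma>\<close> need not be continuous there: absolute convergence of the latter
  at the single point \<open>t\<close> suffices for convergence of the left difference quotients.\<close>
lemma RL_left_difference_quotient:
  assumes \<gamma>: "0 < \<gamma>" "\<gamma> \<le> 1" and t: "t \<in> {a<..b}"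
    and F: "integrable M F" "RL_exists \<gamma> F t"
    and X: "\<And>n. X n \<in> {a<..<t}" "X \<longlonglongrightarrow> t"
  shows "(\<lambda>n. (RL (1 + \<gamma>) F (X n) - RL (1 + \<gamma>) F t) / (\<phi> (X n) - \<phi> t)) \<longlonglongrightarrow> RL \<gamma> F t"
proof -
  have Xb: "X n \<in> {a..b}" and tb: "t \<in> {a..b}" for n using X(1)[of n] t by auto
  have less: "\<phi> (X n) < \<phi> t" for n using X(1)[of n] t by (intro phi_strict) auto
  let ?q = "\<lambda>n s. (power_kernel (1 + \<gamma>) (\<phi> (X n) - \<phi> s) - power_kernel (1 + \<gamma>) (\<phi> t - \<phi> s)) / (\<phi> (X n) - \<phi> t)"
  have q: "(RL (1 + \<gamma>) F (X n) - RL (1 + \<gamma>) F t) / (\<phi> (X n) - \<phi> t) = (\<integral>s. ?q n s * F s \<partial>M)" for n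
  proof -
    have "RL_exists (1 + \<gamma>) F (X n)" "RL_exists (1 + \<gamma>) F t"
      using \<gamma> F Xb tb by (auto intro!: RL_exists_ge_1)
    then have "RL (1 + \<gamma>) F (X n) - RL (1 + \<gamma>) F t =
        (\<integral>s. power_kernel (1 + \<gamma>) (\<phi> (X n) - \<phi> s) * F s - power_kernel (1 + \<gamma>) (\<phi> t - \<phi> s) * F s \<partial>M)"
      by (simp add: RL_def)
    then show ?thesis
      by (simp flip: left_diff_distrib integral_divide_zero)
  qed
  have phi: "(\<lambda>n. \<phi> (X n)) \<longlonglongrightarrow> \<phi> t"
    using continuous_on_tendsto_compose[OF cont_phi X(2) tb] Xb by simp
  show ?thesis
    unfolding q RL_def[of \<gamma>]
  proof (rule integral_dominated_convergence[where w = "\<lambda>s. \<bar>power_kernel \<gamma> (\<phi> t - \<phi> s) * F s\<bar> / \<gamma>"])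
    show "(\<lambda>s. power_kernel \<gamma> (\<phi> t - \<phi> s) * F s) \<in> borel_measurable M"
      using F by measurable
    show "(\<lambda>s. ?q n s * F s) \<in> borel_measurable M" for n
      using F by measurable
    show "integrable M (\<lambda>s. \<bar>power_kernel \<gamma> (\<phi> t - \<phi> s) * F s\<bar> / \<gamma>)"
      using F by (intro integrable_divide_zero integrable_abs) auto
    have "(\<lambda>n. ?q n s) \<longlonglongrightarrow> power_kernel \<gamma> (\<phi> t - \<phi> s)" if s: "s \<in> {a..b}" for s
    proof (cases "s < t")
      case True
      then have "(power_kernel (1 + \<gamma>) has_real_derivative power_kernel \<gamma> (\<phi> t - \<phi> s)) (at (\<phi> t - \<phi> s))"
        using s tb phi_strict[of s t] \<gamma> by (intro power_kernel_has_derivative) auto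
      then have "((\<lambda>x. (power_kernel (1 + \<gamma>) x - power_kernel (1 + \<gamma>) (\<phi> t - \<phi> s)) / (x - (\<phi> t - \<phi> s)))
          \<longlongrightarrow> power_kernel \<gamma> (\<phi> t - \<phi> s)) (at (\<phi> t - \<phi> s))"
        by (simp add: has_field_derivative_iff)
      moreover have "filterlim (\<lambda>n. \<phi> (X n) - \<phi> s) (at (\<phi> t - \<phi> s)) sequentially"
        using less by (auto simp: filterlim_at less_imp_neq intro!: tendsto_intros phi)
      ultimately have "((\<lambda>n. (power_kernel (1 + \<gamma>) (\<phi> (X n) - \<phi> s) - power_kernel (1 + \<gamma>) (\<phi> t - \<phi> s)) /
          ((\<phi> (X n) - \<phi> s) - (\<phi> t - \<phi> s))) \<longlonglongrightarrow> power_kernel \<gamma> (\<phi> t - \<phi> s))"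
        by (rule filterlim_compose)
      then show ?thesis by simp
    next
      \<comment> \<open>Here the approach from the left matters: for s \<ge> t both kernel arguments
        are nonpositive, so the quotient is identically 0.\<close>
      case False
      then have "\<phi> t \<le> \<phi> s" using s tb phi_le_iff[of t s] by auto
      moreover have "\<phi> (X n) \<le> \<phi> s" for n using calculation less[of n] by simp
      ultimately show ?thesis by simp
    qed
    then show "AE s in M. (\<lambda>n. ?q n s * F s) \<longlonglongrightarrow> power_kernel \<gamma> (\<phi> t - \<phi> s) * F s"
      by (intro AE_I2 tendsto_intros) auto
    have "norm (?q n s * F s) \<le> \<bar>power_kernel \<gamma> (\<phi> t - \<phi> s) * F s\<bar> / \<gamma>" for n s
    proof -
      \<comment> \<open>The quotient bound is applied with e = \<phi>(t) -
        \<phi>(\<open>X n\<close>); being uniform in e, it yields one dominating function for all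
        n.\<close>
      have "\<bar>?q n s\<bar> = \<bar>power_kernel (1 + \<gamma>) (\<phi> t - \<phi> s) - power_kernel (1 + \<gamma>) (\<phi> t - \<phi> s - (\<phi> t - \<phi> (X n)))\<bar> / (\<phi> t - \<phi> (X n))"
        using less[of n] by (simp add: abs_minus_commute)
      also have "\<dots> \<le> power_kernel \<gamma> (\<phi> t - \<phi> s) / \<gamma>"
        using \<gamma> less[of n] by (intro power_kernel_diff_quotient_bound) auto
      finally have "\<bar>?q n s\<bar> * \<bar>F s\<bar> \<le> power_kernel \<gamma> (\<phi> t - \<phi> s) / \<gamma> * \<bar>F s\<bar>"
        by (rule mult_right_mono) simp
      then show ?thesis
        using power_kernel_nonneg[OF \<gamma>(1), of "\<phi> t - \<phi> s"] by (simp add: abs_mult)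
    qed
    then show "AE s in M. norm (?q n s * F s) \<le> \<bar>power_kernel \<gamma> (\<phi> t - \<phi> s) * F s\<bar> / \<gamma>" for n
      by (intro AE_I2) auto
  qed
qed

text \<open>An existing derivative can be computed along a single sequence, and along one from the
  left the limit is known. Dividing by the difference quotients of \<phi> converts increments in t
  into increments in \<phi>.\<close>

lemma RL_derivative_eq:
  assumes \<gamma>: "0 < \<gamma>" "\<gamma> \<le> 1" and t: "t \<in> {a<..b}"
    and F: "integrable M F" "RL_exists \<gamma> F t"
    and D: "(RL (1 + \<gamma>) F has_real_derivative D) (at t within {a<..b})"
  shows "D = \<phi>' t * RL \<gamma> F t"
proof -
  \<comment> \<open>The double successor keeps the factor at most 1/2, so that even the first term
    lies strictly between a and t.\<close>
  define X where "X n = t - (t - a) * inverse (real (Suc (Suc n)))" for n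
  have X: "X n \<in> {a<..<t}" for n
  proof -
    have "inverse (real (Suc (Suc n))) < 1" "0 < inverse (real (Suc (Suc n)))"
      by (auto simp: inverse_less_1_iff)
    then have "(t - a) * inverse (real (Suc (Suc n))) < (t - a) * 1" "0 < (t - a) * inverse (real (Suc (Suc n)))"
      using t by (auto intro!: mult_strict_left_mono mult_pos_pos)
    then show ?thesis by (simp add: X_def)
  qed
  have "(\<lambda>n. inverse (real (Suc (Suc n)))) \<longlonglongrightarrow> 0"
    using LIMSEQ_Suc[OF LIMSEQ_inverse_real_of_nat] .
  then have "X \<longlonglongrightarrow> t - (t - a) * 0"
    unfolding X_def[abs_def] by (intro tendsto_intros)
  then have lim: "X \<longlonglongrightarrow> t" by simp
  have X': "filterlim X (at t within {a<..b}) sequentially"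
    using X t lim by (auto simp: filterlim_at less_imp_neq less_imp_le intro!: always_eventually)
      (metis less_le_trans less_imp_le)+
  have less: "\<phi> (X n) < \<phi> t" for n using X[of n] t by (intro phi_strict) auto
  have "(\<phi> has_real_derivative \<phi>' t) (at t within {a<..b})"
    using t by (intro has_field_derivative_subset[OF phi_deriv]) auto
  then have "(\<lambda>n. (\<phi> (X n) - \<phi> t) / (X n - t)) \<longlonglongrightarrow> \<phi>' t"
    unfolding has_field_derivative_iff using X' by (rule filterlim_compose)
  moreover have "(\<lambda>n. (RL (1 + \<gamma>) F (X n) - RL (1 + \<gamma>) F t) / (X n - t)) \<longlonglongrightarrow> D"
    using D unfolding has_field_derivative_iff using X' by (rule filterlim_compose)
  moreover have "\<phi>' t \<noteq> 0" using phi'_pos[of t] t by auto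
  ultimately have "(\<lambda>n. (RL (1 + \<gamma>) F (X n) - RL (1 + \<gamma>) F t) / (X n - t) /
      ((\<phi> (X n) - \<phi> t) / (X n - t))) \<longlonglongrightarrow> D / \<phi>' t"
    by (intro tendsto_divide)
  moreover have quot: "(RL (1 + \<gamma>) F (X n) - RL (1 + \<gamma>) F t) / (X n - t) / ((\<phi> (X n) - \<phi> t) / (X n - t))
      = (RL (1 + \<gamma>) F (X n) - RL (1 + \<gamma>) F t) / (\<phi> (X n) - \<phi> t)" for n
    using X[of n] less[of n] by (simp add: divide_simps)
  ultimately have "(\<lambda>n. (RL (1 + \<gamma>) F (X n) - RL (1 + \<gamma>) F t) / (\<phi> (X n) - \<phi> t)) \<longlonglongrightarrow> D / \<phi>' t"
    unfolding quot by - assumption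
  with RL_left_difference_quotient[OF \<gamma> t F X lim] have "D / \<phi>' t = RL \<gamma> F t"
    by (rule LIMSEQ_unique[symmetric])
  then show ?thesis using \<open>\<phi>' t \<noteq> 0\<close> by (simp add: field_simps)
qed

section \<open>Integrability and existence of fractional integrals\<close>

lemma RL_exists_imp_measurable:
  assumes "0 < \<alpha>" "RL_exists \<alpha> F b"
  shows "F \<in> borel_measurable M"
proof -
  \<comment> \<open>The kernel at \<phi>(b) - \<phi>(s) is nonzero for s < b and can be divided out;
    s = b, where it vanishes, is set apart.\<close>
  have "(\<lambda>s. if s = b then F b else power_kernel \<alpha> (\<phi> b - \<phi> s) * F s / power_kernel \<alpha> (\<phi> b - \<phi> s)) \<in> borel_measurable M"
    using assms(2) by (intro measurable_If borel_measurable_divide) (auto simp: sets_M sets_restrict_space)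
  also have "?this \<longleftrightarrow> ?thesis"
  proof (intro measurable_cong)
    fix s assume s: "s \<in> space M"
    have "power_kernel \<alpha> (\<phi> b - \<phi> s) \<noteq> 0" if "s \<noteq> b"
      using s that phi_strict[of s b] Gamma_real_neq_0[OF assms(1)] by (simp add: power_kernel_def)
    then show "(if s = b then F b else power_kernel \<alpha> (\<phi> b - \<phi> s) * F s / power_kernel \<alpha> (\<phi> b - \<phi> s)) = F s"
      by simp
  qed
  finally show ?thesis .
qed

text \<open>For order at most 1 the kernel does not increase with its argument, so for s in [a,b) it
  is bounded below by C, its value for s = a.\<close>

lemma RL_exists_imp_integrable_le_1:
  assumes "0 < \<alpha>" "\<alpha> \<le> 1" "RL_exists \<alpha> F b"
  shows "integrable M F"
proof -
  define C where "C = (\<phi> b - \<phi> a) powr (\<alpha> - 1) / Gamma \<alpha>"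
  have pos: "0 < \<phi> b - \<phi> a" using a_less_b phi_strict[of a b] by auto
  then have C: "0 < C" using assms by (simp add: C_def Gamma_real_pos)
  show ?thesis
  proof (rule Bochner_Integration.integrable_bound)
    show "integrable M (\<lambda>s. power_kernel \<alpha> (\<phi> b - \<phi> s) * F s / C)"
      using assms(3) by (rule integrable_divide_zero) 
    show "F \<in> borel_measurable M" using assms by (intro RL_exists_imp_measurable)
    show "AE s in M. norm (F s) \<le> norm (power_kernel \<alpha> (\<phi> b - \<phi> s) * F s / C)"
      using AE_M_neq[of b] AE_space
    proof eventually_elim
      case (elim s)
      then have "0 < \<phi> b - \<phi> s" "\<phi> b - \<phi> s \<le> \<phi> b - \<phi> a"
        using phi_strict[of s b] phi_le_iff[of a s] by auto
      then have "C \<le> power_kernel \<alpha> (\<phi> b - \<phi> s)"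
        using assms by (auto simp: C_def power_kernel_def Gamma_real_pos less_imp_le
          intro!: divide_right_mono powr_mono2')
      then have "C * \<bar>F s\<bar> \<le> power_kernel \<alpha> (\<phi> b - \<phi> s) * \<bar>F s\<bar>"
        by (intro mult_right_mono) auto
      then show ?case using C by (simp add: abs_mult field_simps power_kernel_nonneg[OF assms(1)])
    qed
  qed
qed

text \<open>Among s \<le> t the kernel can degenerate only at s = t, by vanishing or by blowing up.
  On [a,c] with c < t it is continuous and positive, hence comparable to a constant; on [c,b] the
  function F is bounded.\<close>

lemma
  assumes "0 < \<alpha>" "t \<in> {a<..b}" "continuous_on {a<..b} F"
  shows RL_exists_imp_integrable_continuous: "\<lbrakk>t = b; RL_exists \<alpha> F t\<rbrakk> \<Longrightarrow> integrable M F"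
    and RL_exists_continuous_open: "integrable M F \<Longrightarrow> RL_exists \<alpha> F t"
proof -
  define c where "c = (a + t) / 2"
  have c: "a < c" "c < t" "c < b" using assms by (auto simp: c_def)
  let ?k = "\<lambda>s. power_kernel \<alpha> (\<phi> t - \<phi> s)"
  have pos: "0 < \<phi> t - \<phi> s" if "s \<in> {a..c}" for s
    using that c assms phi_strict[of s t] by auto
  have kcont: "continuous_on {a..c} ?k"
  proof -
    have "continuous_on {a..c} (\<lambda>s. (\<phi> t - \<phi> s) powr (\<alpha> - 1) / Gamma \<alpha>)"
      using pos Gamma_real_neq_0[OF assms(1)] c
      by (intro continuous_intros continuous_on_subset[OF cont_phi]) (auto simp: less_imp_neq[symmetric] dest: less_imp_neq)
    also have "?this \<longleftrightarrow> ?thesis"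
      using pos by (intro continuous_on_cong refl) (simp add: power_kernel_def)
    finally show ?thesis .
  qed
  have kpos: "0 < ?k s" if "s \<in> {a..c}" for s
    using pos[OF that] assms by (simp add: power_kernel_def Gamma_real_pos)
  have "bounded (F ` {c..b})"
    using c by (intro compact_imp_bounded compact_continuous_image continuous_on_subset[OF assms(3)]) auto
  then obtain B where B: "\<forall>x \<in> F ` {c..b}. norm x \<le> B" unfolding bounded_iff by blast
  then have "norm (F c) \<le> B" using c by auto
  then have B0: "0 \<le> B" using norm_ge_zero order_trans by blast
  have nonneg: "0 \<le> ?k s" for s by (rule power_kernel_nonneg[OF assms(1)])
  show "integrable M F" if t: "t = b" and int: "RL_exists \<alpha> F t"
  proof -
    obtain x where x: "x \<in> {a..c}" "\<And>s. s \<in> {a..c} \<Longrightarrow> ?k x \<le> ?k s"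
      using continuous_attains_inf[OF compact_Icc _ kcont] c by auto
    show ?thesis
    proof (rule Bochner_Integration.integrable_bound)
      show "integrable M (\<lambda>s. \<bar>?k s * F s\<bar> / ?k x + B)"
        using int by (intro Bochner_Integration.integrable_add integrable_divide_zero integrable_abs) auto
      show "F \<in> borel_measurable M"
        using int t assms by (intro RL_exists_imp_measurable) auto
      have "norm (F s) \<le> norm (\<bar>?k s * F s\<bar> / ?k x + B)" if "s \<in> {a..b}" for s
      proof (cases "s \<le> c")
        case True
        then have "?k x * \<bar>F s\<bar> \<le> ?k s * \<bar>F s\<bar>"
          using that x(2) by (intro mult_right_mono) auto
        then have "\<bar>F s\<bar> \<le> \<bar>?k s * F s\<bar> / ?k x"
          using kpos[OF x(1)] nonneg[of s] by (simp add: abs_mult field_simps)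
        then show ?thesis using B0 by simp
      next
        case False
        then have "\<bar>F s\<bar> \<le> B" using that B by auto
        moreover have "0 \<le> \<bar>?k s * F s\<bar> / ?k x" using nonneg[of x] by simp
        ultimately show ?thesis by simp
      qed
      then show "AE s in M. norm (F s) \<le> norm (\<bar>?k s * F s\<bar> / ?k x + B)" by (intro AE_I2) auto
    qed
  qed
  show "RL_exists \<alpha> F t" if int: "integrable M F"
  proof -
    obtain x where x: "x \<in> {a..c}" "\<And>s. s \<in> {a..c} \<Longrightarrow> ?k s \<le> ?k x"
      using continuous_attains_sup[OF compact_Icc _ kcont] c by auto
    show ?thesis
    proof (rule Bochner_Integration.integrable_bound)
      show "integrable M (\<lambda>s. ?k x * \<bar>F s\<bar> + ?k s * B)"
        using int assms integrable_kernel(1)[of \<alpha> t]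
        by (intro Bochner_Integration.integrable_add integrable_mult_right integrable_mult_left integrable_abs) auto
      show "(\<lambda>s. ?k s * F s) \<in> borel_measurable M" using int by measurable
      have "norm (?k s * F s) \<le> norm (?k x * \<bar>F s\<bar> + ?k s * B)" if "s \<in> {a..b}" for s
      proof (cases "s \<le> c")
        case True
        then have "?k s * \<bar>F s\<bar> \<le> ?k x * \<bar>F s\<bar>"
          using that x(2) by (intro mult_right_mono) auto
        moreover have "0 \<le> ?k s * B" using nonneg B0 by simp
        ultimately show ?thesis using nonneg[of s] by (simp add: abs_mult)
      next
        case False
        then have "?k s * \<bar>F s\<bar> \<le> ?k s * B"
          using that B nonneg by (intro mult_left_mono) auto
        moreover have "0 \<le> ?k x * \<bar>F s\<bar>" using nonneg[of x] by simp
        ultimately show ?thesis using nonneg[of s] by (simp add: abs_mult)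
      qed
      then show "AE s in M. norm (?k s * F s) \<le> norm (?k x * \<bar>F s\<bar> + ?k s * B)" by (intro AE_I2) auto
    qed
  qed
qed

subsection \<open>The Hilfer equation\<close>

lemma at_within_neq_bot: "t \<in> {a<..b} \<Longrightarrow> at t within {a<..b} \<noteq> bot"
proof -
  assume t: "t \<in> {a<..b}"
  then have "at t within {a<..<t} \<noteq> bot"
    by (simp add: at_within_eq_bot_iff trivial_limit_within islimpt_greaterThanLessThan2)
  then show ?thesis
    using at_le[of "{a<..<t}" "{a<..b}" t] t by (metis bot.extremum_uniqueI greaterThanAtMost_iff
        greaterThanLessThan_iff less_imp_le order.trans subsetI)
qed

lemma phi_deriv_eq:
  assumes "t \<in> {a<..b}" "(f has_real_derivative \<phi>' t * D) (at t within {a<..b})"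
  shows "phi_deriv \<phi>' a b f t = D"
proof -
  have "vector_derivative f (at t within {a<..b}) = \<phi>' t * D"
    using assms at_within_neq_bot
    by (intro vector_derivative_within) (auto simp: has_real_derivative_iff_has_vector_derivative)
  then show ?thesis using phi'_pos[of t] assms by (simp add: phi_deriv_def)
qed

lemma differentiable_imp_phi_deriv:
  assumes "t \<in> {a<..b}" "f differentiable (at t within {a<..b})"
  shows "(f has_real_derivative \<phi>' t * phi_deriv \<phi>' a b f t) (at t within {a<..b})"
  using assms phi'_pos[of t]
  by (simp add: phi_deriv_def vector_derivative_works has_real_derivative_iff_has_vector_derivative)

lemma integrable_continuous:
  fixes f :: "real \<Rightarrow> real"
  assumes "continuous_on {a..b} f" shows "integrable M f"
  unfolding integrable_M_iff
  by (intro borel_integrable_atLeastAtMost' continuous_intros assms cont_phi')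

lemma continuous_on_kernel_phi:
  assumes "1 < \<alpha>" shows "continuous_on {a..b} (\<lambda>s. power_kernel \<alpha> (\<phi> s - \<phi> a))"
  by (intro continuous_on_compose2[OF continuous_on_power_kernel[OF assms]] continuous_intros cont_phi) auto

lemma phi_ge: "t \<in> {a..b} \<Longrightarrow> 0 \<le> \<phi> t - \<phi> a"
  using phi_le_iff[of a t] a_less_b by auto

lemma RL_RL_integrable:
  assumes "0 < \<alpha>" "0 < \<beta>" "1 \<le> \<alpha> + \<beta>" "t \<in> {a..b}" "integrable M f"
  shows "RL \<alpha> (RL \<beta> f) t = RL (\<alpha> + \<beta>) f t"
  using assms by (intro RL_RL RL_exists_ge_1 borel_measurable_integrable)

text \<open>The homogeneous part is itself a kernel, so the semigroup law raises both orders by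
  \<alpha>. Besides the orders \<xi>, \<mu> of a solution this serves the intermediate expansions
  with orders 2, 2 and \<xi>, \<xi>.\<close>

lemma RL_general_solution:
  assumes "0 < \<alpha>" "1 < \<xi>" "1 < \<mu>" and h: "integrable M h" and t: "t \<in> {a..b}"
  shows "RL \<alpha> (\<lambda>s. c * power_kernel \<xi> (\<phi> s - \<phi> a) + RL \<mu> h s) t
    = c * power_kernel (\<alpha> + \<xi>) (\<phi> t - \<phi> a) + RL (\<alpha> + \<mu>) h t"
proof -
  have "RL \<alpha> (\<lambda>s. c * power_kernel \<xi> (\<phi> s - \<phi> a) + RL \<mu> h s) t
      = c * RL \<alpha> (\<lambda>s. power_kernel \<xi> (\<phi> s - \<phi> a)) t + RL \<alpha> (RL \<mu> h) t"
    using assms unfolding RL_cmult[symmetric]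
    by (intro RL_add RL_exists_continuous continuous_intros continuous_on_kernel_phi continuous_on_RL) auto
  also have "RL \<alpha> (RL \<mu> h) t = RL (\<alpha> + \<mu>) h t"
    using assms by (intro RL_RL_integrable) auto
  finally show ?thesis using assms by (simp add: RL_kernel)
qed

text \<open>Orders below 1 are included here: boundedness of y dominates the integral by a multiple
  of the kernel of order \<beta> + 1, which is continuous and vanishes at t = a.\<close>

lemma RL_bounded_tendsto_0:
  assumes "0 < \<beta>" and y: "continuous_on {a..b} y"
  shows "(RL \<beta> y \<longlongrightarrow> 0) (at_right a)"
proof -
  have "bounded (y ` {a..b})"
    by (intro compact_imp_bounded compact_continuous_image y compact_Icc)
  then obtain B where B: "\<forall>x\<in>y ` {a..b}. norm x \<le> B"
    unfolding bounded_iff by blast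
  have le: "norm (RL \<beta> y t) \<le> B * power_kernel (\<beta> + 1) (\<phi> t - \<phi> a)" if t: "t \<in> {a..b}" for t
  proof -
    have int: "RL_exists \<beta> y t" using assms t by (intro RL_exists_continuous)
    have "norm (RL \<beta> y t) \<le> (\<integral>s. norm (power_kernel \<beta> (\<phi> t - \<phi> s) * y s) \<partial>M)"
      unfolding RL_def by (rule integral_norm_bound)
    also have "\<dots> \<le> (\<integral>s. B * power_kernel \<beta> (\<phi> t - \<phi> s) \<partial>M)"
    proof (rule integral_mono)
      show "integrable M (\<lambda>s. norm (power_kernel \<beta> (\<phi> t - \<phi> s) * y s))"
        using int by (rule integrable_norm)
      show "integrable M (\<lambda>s. B * power_kernel \<beta> (\<phi> t - \<phi> s))"
        using integrable_kernel(1)[OF assms(1) t] by simp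
      fix s assume "s \<in> space M"
      then have "\<bar>y s\<bar> * power_kernel \<beta> (\<phi> t - \<phi> s) \<le> B * power_kernel \<beta> (\<phi> t - \<phi> s)"
        using B power_kernel_nonneg[OF assms(1)] by (intro mult_right_mono) auto
      then show "norm (power_kernel \<beta> (\<phi> t - \<phi> s) * y s) \<le> B * power_kernel \<beta> (\<phi> t - \<phi> s)"
        using power_kernel_nonneg[OF assms(1), of "\<phi> t - \<phi> s"] by (simp add: abs_mult mult.commute)
    qed
    also have "\<dots> = B * power_kernel (\<beta> + 1) (\<phi> t - \<phi> a)"
      using integrable_kernel(2)[OF assms(1) t] by simp
    finally show ?thesis .
  qed
  have "continuous_on {a..b} (\<lambda>t. B * power_kernel (\<beta> + 1) (\<phi> t - \<phi> a))"
    using assms by (intro continuous_intros continuous_on_kernel_phi) auto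
  then have "((\<lambda>t. B * power_kernel (\<beta> + 1) (\<phi> t - \<phi> a)) \<longlongrightarrow> B * power_kernel (\<beta> + 1) (\<phi> a - \<phi> a)) (at a within {a..b})"
    using a_less_b unfolding continuous_on by (metis atLeastAtMost_iff order.refl order.strict_implies_order)
  then have "((\<lambda>t. B * power_kernel (\<beta> + 1) (\<phi> t - \<phi> a)) \<longlongrightarrow> 0) (at a within {a..b})" by simp
  then have "(RL \<beta> y \<longlongrightarrow> 0) (at a within {a..b})"
  proof (rule Lim_null_comparison[rotated])
    show "\<forall>\<^sub>F t in at a within {a..b}. norm (RL \<beta> y t) \<le> B * power_kernel (\<beta> + 1) (\<phi> t - \<phi> a)"
      unfolding eventually_at_filter using le by (auto intro: always_eventually)
  qed
  then show ?thesis using a_less_b by (simp add: at_within_Icc_at_right)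
qed

text \<open>Of the two constants of integration, the limit 0 at a removes the additive one; the
  other survives as the slope c with respect to \<phi>.\<close>

lemma twice_antiderivative:
  assumes F: "integrable M F"
    and g: "\<And>t. t \<in> {a<..b} \<Longrightarrow> (g has_real_derivative \<phi>' t * g' t) (at t within {a<..b})"
    and g': "\<And>t. t \<in> {a<..b} \<Longrightarrow> (g' has_real_derivative \<phi>' t * F t) (at t within {a<..b})"
    and lim: "(g \<longlongrightarrow> 0) (at_right a)"
  shows "\<exists>c. \<forall>t\<in>{a<..b}. g t = c * power_kernel 2 (\<phi> t - \<phi> a) + RL 2 F t"
proof -
  obtain c where c: "\<And>t. t \<in> {a<..b} \<Longrightarrow> g' t = c + RL 1 F t"
    using antiderivative_RL_one[OF F g'] by blast
  have cont: "continuous_on {a..b} (\<lambda>t. c + RL 1 F t)"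
    using F by (intro continuous_intros continuous_on_RL) auto
  have "(g has_real_derivative \<phi>' t * (c + RL 1 F t)) (at t within {a<..b})" if "t \<in> {a<..b}" for t
    using g[OF that] c[OF that] by simp
  then obtain d where d: "\<And>t. t \<in> {a<..b} \<Longrightarrow> g t = d + RL 1 (\<lambda>t. c + RL 1 F t) t"
    using antiderivative_RL_one[OF integrable_continuous[OF cont], of g] by blast
  have "((\<lambda>t. d + RL 1 (\<lambda>t. c + RL 1 F t) t) \<longlongrightarrow> d + 0) (at_right a)"
    by (intro tendsto_intros RL_tendsto_0 integrable_continuous cont) auto
  moreover have "\<forall>\<^sub>F t in at_right a. d + RL 1 (\<lambda>t. c + RL 1 F t) t = g t"
    using a_less_b d by (intro eventually_at_rightI[of a b]) auto
  ultimately have "(g \<longlongrightarrow> d + 0) (at_right a)"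
    by (rule Lim_transform_eventually)
  then have "(g \<longlongrightarrow> d) (at_right a)" by simp
  then have "d = 0" using lim tendsto_unique trivial_limit_at_right_real by blast
  show ?thesis
  proof (intro exI ballI)
    fix t assume t: "t \<in> {a<..b}"
    then have tb: "t \<in> {a..b}" by auto
    have "RL 1 (\<lambda>t. c + RL 1 F t) t = RL 1 (\<lambda>_. c) t + RL 1 (RL 1 F) t"
      using tb F by (intro RL_add RL_exists_continuous continuous_intros continuous_on_RL) auto
    also have "RL 1 (\<lambda>_. c) t = c * power_kernel 2 (\<phi> t - \<phi> a)"
      using RL_cmult[of 1 c "\<lambda>_. 1" t] integrable_kernel(2)[OF zero_less_one tb] by (simp add: RL_def)
    also have "RL 1 (RL 1 F) t = RL 2 F t"
      using RL_RL_integrable[of 1 1 t F] tb F by simp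
    finally show "g t = c * power_kernel 2 (\<phi> t - \<phi> a) + RL 2 F t"
      using d[OF t] \<open>d = 0\<close> by simp
  qed
qed

section \<open>The differential equation in both directions\<close>

lemma phi_frac_integral_0 [simp]: "phi_frac_integral \<phi> \<phi>' a 0 f = f"
  by (simp add: phi_frac_integral_def fun_eq_iff)

lemma Hilfer_existsD:
  assumes "phi_Hilfer_deriv_exists \<phi> \<phi>' a b 2 \<mu> \<nu> y"
  defines "g \<equiv> phi_frac_integral \<phi> \<phi>' a ((1 - \<nu>) * (2 - \<mu>)) y"
  shows "t \<in> {a<..b} \<Longrightarrow> (g has_real_derivative \<phi>' t * phi_deriv \<phi>' a b g t) (at t within {a<..b})"
    and "t \<in> {a<..b} \<Longrightarrow> (phi_deriv \<phi>' a b g has_real_derivative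
      \<phi>' t * phi_deriv \<phi>' a b (phi_deriv \<phi>' a b g) t) (at t within {a<..b})"
    and "t \<in> {a<..b} \<Longrightarrow> phi_frac_integral_exists \<phi> \<phi>' a (\<nu> * (2 - \<mu>)) (phi_deriv \<phi>' a b (phi_deriv \<phi>' a b g)) t"
proof -
  have *: "\<forall>k<2. \<forall>t\<in>{a<..b}. (phi_deriv \<phi>' a b ^^ k) g differentiable (at t within {a<..b})"
    "\<forall>t\<in>{a<..b}. phi_frac_integral_exists \<phi> \<phi>' a (\<nu> * (2 - \<mu>)) (phi_deriv \<phi>' a b (phi_deriv \<phi>' a b g)) t"
    using assms by (auto simp: phi_Hilfer_deriv_exists_def Let_def numeral_2_eq_2)
  show "(g has_real_derivative \<phi>' t * phi_deriv \<phi>' a b g t) (at t within {a<..b})" if "t \<in> {a<..b}"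
    using *(1)[rule_format, of 0 t] that by (intro differentiable_imp_phi_deriv) auto
  show "(phi_deriv \<phi>' a b g has_real_derivative
      \<phi>' t * phi_deriv \<phi>' a b (phi_deriv \<phi>' a b g) t) (at t within {a<..b})" if "t \<in> {a<..b}"
    using *(1)[rule_format, of 1 t] that by (intro differentiable_imp_phi_deriv) auto
  show "phi_frac_integral_exists \<phi> \<phi>' a (\<nu> * (2 - \<mu>)) (phi_deriv \<phi>' a b (phi_deriv \<phi>' a b g)) t"
    if "t \<in> {a<..b}" using *(2) that by blast
qed

lemma phi_Hilfer_deriv_2:
  "phi_Hilfer_deriv \<phi> \<phi>' a b 2 \<mu> \<nu> y = phi_frac_integral \<phi> \<phi>' a (\<nu> * (2 - \<mu>))
    (phi_deriv \<phi>' a b (phi_deriv \<phi>' a b (phi_frac_integral \<phi> \<phi>' a ((1 - \<nu>) * (2 - \<mu>)) y)))"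
  by (simp add: phi_Hilfer_deriv_def numeral_2_eq_2)

lemma Hilfer_solution_form:
  assumes \<mu>: "1 < \<mu>" "\<mu> < 2" and \<nu>: "0 \<le> \<nu>" "\<nu> \<le> 1" and \<xi>: "\<xi> = \<mu> + \<nu> * (2 - \<mu>)"
    and h: "integrable M h"
    and ex: "phi_Hilfer_deriv_exists \<phi> \<phi>' a b 2 \<mu> \<nu> y"
    and eq: "\<And>t. t \<in> {a<..b} \<Longrightarrow> phi_Hilfer_deriv \<phi> \<phi>' a b 2 \<mu> \<nu> y t = h t"
    and y: "continuous_on {a..b} y" "y a = 0"
  shows "\<exists>c. \<forall>t\<in>{a..b}. y t = c * power_kernel \<xi> (\<phi> t - \<phi> a) + RL \<mu> h t"
proof -
  define \<beta> where "\<beta> = (1 - \<nu>) * (2 - \<mu>)"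
  define \<gamma> where "\<gamma> = \<nu> * (2 - \<mu>)"
  have "\<beta> \<le> 1 * (2 - \<mu>)" "\<gamma> \<le> 1 * (2 - \<mu>)"
    unfolding \<beta>_def \<gamma>_def using \<mu> \<nu> by (intro mult_right_mono; simp)+
  then have ord: "0 \<le> \<beta>" "\<beta> < 1" "0 \<le> \<gamma>" "\<gamma> < 1" "\<mu> + \<gamma> = \<xi>" "\<xi> = 2 - \<beta>"
    using \<mu> \<nu> by (auto simp: \<beta>_def \<gamma>_def \<xi> algebra_simps)
  define g where "g = phi_frac_integral \<phi> \<phi>' a \<beta> y"
  define f where "f = phi_deriv \<phi>' a b (phi_deriv \<phi>' a b g)"
  note exD = Hilfer_existsD[OF ex, folded \<beta>_def \<gamma>_def, folded g_def, folded f_def]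
  have eq': "phi_frac_integral \<phi> \<phi>' a \<gamma> f t = h t" if "t \<in> {a<..b}" for t
    using eq[OF that] by (simp add: phi_Hilfer_deriv_2 f_def g_def \<beta>_def \<gamma>_def)
  \<comment> \<open>The equation controls f only on (a,b]. For \<gamma> = 0 it equals h there, and h
    is the integrable representative; for \<gamma> > 0 existence of the outer integral at b makes f
    itself integrable.\<close>
  obtain F where F: "integrable M F" "\<And>t. t \<in> {a<..b} \<Longrightarrow> f t = F t"
    "\<And>t. t \<in> {a..b} \<Longrightarrow> RL \<xi> F t = RL \<mu> h t"
  proof (cases "\<gamma> = 0")
    case True
    then show ?thesis using that[of h] eq' h ord by simp
  next
    case False
    then have \<gamma>: "0 < \<gamma>" using ord by simp
    then have ei: "RL_exists \<gamma> f t" if "t \<in> {a<..b}" for t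
      using exD(3)[OF that] that by (simp add: phi_frac_integral_exists_iff)
    then have f: "integrable M f"
      using RL_exists_imp_integrable_le_1[OF \<gamma> _ ei] ord(4) a_less_b by simp
    have "RL \<xi> f t = RL \<mu> h t" if t: "t \<in> {a..b}" for t
    proof -
      have "RL \<mu> h t = RL \<mu> (RL \<gamma> f) t"
      proof (rule RL_cong)
        fix s assume "s \<in> {a<..b}"
        then show "h s = RL \<gamma> f s"
          using eq'[of s] phi_frac_integral_eq[OF \<gamma>, of s f] by simp
      qed (use h f in measurable)
      also have "\<dots> = RL (\<mu> + \<gamma>) f t"
        using \<gamma> \<mu> t f by (intro RL_RL_integrable) auto
      finally show ?thesis using ord by simp
    qed
    then show ?thesis using that[of f] f by blast
  qed
  \<comment> \<open>For \<beta> = 0 the limit is y(a) = 0; for \<beta> > 0 boundedness of y already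
    forces it.\<close>
  have g_lim: "(g \<longlongrightarrow> 0) (at_right a)"
  proof (cases "\<beta> = 0")
    case True
    then have "g = y" by (simp add: g_def)
    moreover have "(y \<longlongrightarrow> y a) (at a within {a..b})"
      using y a_less_b unfolding continuous_on by (metis atLeastAtMost_iff order.refl order.strict_implies_order)
    ultimately show ?thesis using y a_less_b by (simp add: at_within_Icc_at_right)
  next
    case False
    then have \<beta>: "0 < \<beta>" using ord by simp
    have "(RL \<beta> y \<longlongrightarrow> 0) (at_right a)" using RL_bounded_tendsto_0[OF \<beta> y(1)] .
    moreover have "\<forall>\<^sub>F t in at_right a. RL \<beta> y t = g t"
      using \<beta> a_less_b by (intro eventually_at_rightI[of a b]) (auto simp: g_def phi_frac_integral_eq)
    ultimately show ?thesis by (rule Lim_transform_eventually)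
  qed
  have exD2: "(phi_deriv \<phi>' a b g has_real_derivative \<phi>' t * F t) (at t within {a<..b})" if "t \<in> {a<..b}" for t
    using exD(2)[OF that] F(2)[OF that] by simp
  obtain c where c: "\<And>t. t \<in> {a<..b} \<Longrightarrow> g t = c * power_kernel 2 (\<phi> t - \<phi> a) + RL 2 F t"
    using twice_antiderivative[OF F(1) exD(1) _ g_lim] exD2 by blast
  have main: "y t = c * power_kernel \<xi> (\<phi> t - \<phi> a) + RL \<xi> F t" if t: "t \<in> {a<..b}" for t
  proof (cases "\<beta> = 0")
    case True
    then show ?thesis using c[OF t] ord by (simp add: g_def)
  next
    case False
    then have \<beta>: "0 < \<beta>" using ord by simp
    \<comment> \<open>The order \<beta> is undone by completing it to 1: applying order 1 - \<beta>
      shows that y and z have equal integrals of order 1. Both are continuous, so differentiation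
      gives y = z.\<close>
    define z where "z t = c * power_kernel \<xi> (\<phi> t - \<phi> a) + RL \<xi> F t" for t
    have \<xi>1: "1 < \<xi>" using ord by simp
    have z: "continuous_on {a..b} z"
      unfolding z_def using \<xi>1 F by (intro continuous_intros continuous_on_kernel_phi continuous_on_RL) auto
    have g: "continuous_on {a..b} (\<lambda>t. c * power_kernel 2 (\<phi> t - \<phi> a) + RL 2 F t)"
      using F by (intro continuous_intros continuous_on_kernel_phi continuous_on_RL) auto
    have "RL 1 y s = RL 1 z s" if s: "s \<in> {a..b}" for s
    proof -
      have "RL 1 y s = RL (1 - \<beta>) (RL \<beta> y) s"
        using RL_RL_integrable[of "1 - \<beta>" \<beta> s y] \<beta> ord(2) s integrable_continuous[OF y(1)] by simp
      also have "\<dots> = RL (1 - \<beta>) (\<lambda>t. c * power_kernel 2 (\<phi> t - \<phi> a) + RL 2 F t) s"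
      proof (rule RL_cong)
        fix s assume "s \<in> {a<..b}"
        then show "RL \<beta> y s = c * power_kernel 2 (\<phi> s - \<phi> a) + RL 2 F s"
          using c[of s] phi_frac_integral_eq[OF \<beta>, of s y] by (simp add: g_def)
      qed (use integrable_continuous[OF y(1)] F(1) in measurable)
      also have "\<dots> = c * power_kernel (1 - \<beta> + 2) (\<phi> s - \<phi> a) + RL (1 - \<beta> + 2) F s"
        using ord F s by (intro RL_general_solution) auto
      also have "1 - \<beta> + 2 = 1 + \<xi>" using ord by simp
      also have "c * power_kernel (1 + \<xi>) (\<phi> s - \<phi> a) + RL (1 + \<xi>) F s = RL 1 z s"
        unfolding z_def using ord F s by (subst RL_general_solution) auto
      finally show ?thesis .
    qed
    then have yz: "RL 1 y s = RL 1 z s" if "s \<in> {a<..b}" for s using that by simp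
    have sub: "{a<..b} \<subseteq> {a..b}" by auto
    have "(RL 1 y has_real_derivative \<phi>' t * y t) (at t within {a<..b})"
      by (rule RL_one_has_derivative[OF integrable_continuous[OF y(1)] continuous_on_subset[OF y(1) sub] t])
    then have "(RL 1 z has_real_derivative \<phi>' t * y t) (at t within {a<..b})"
      by (rule has_field_derivative_transform_within[OF _ zero_less_one t yz])
    moreover have "(RL 1 z has_real_derivative \<phi>' t * z t) (at t within {a<..b})"
      by (rule RL_one_has_derivative[OF integrable_continuous[OF z] continuous_on_subset[OF z sub] t])
    ultimately have "y t = z t"
      using phi_deriv_eq[OF t, of "RL 1 z" "y t"] phi_deriv_eq[OF t, of "RL 1 z" "z t"] by simp
    then show ?thesis by (simp add: z_def)
  qed
  show ?thesis
  proof (intro exI ballI)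
    fix t assume t: "t \<in> {a..b}"
    show "y t = c * power_kernel \<xi> (\<phi> t - \<phi> a) + RL \<mu> h t"
    proof (cases "t = a")
      case False
      then show ?thesis using main[of t] F(3)[of t] t by simp
    qed (simp add: y)
  qed
qed

text \<open>Existence of the Hilfer derivative supplies differentiability at each stage; the
  explicit formula for y then identifies the values of the derivatives.\<close>

lemma Hilfer_deriv_solution:
  assumes \<mu>: "1 < \<mu>" "\<mu> < 2" and \<nu>: "0 \<le> \<nu>" "\<nu> \<le> 1" and \<xi>: "\<xi> = \<mu> + \<nu> * (2 - \<mu>)"
    and h: "integrable M h" "continuous_on {a<..b} h"
    and lim: "(RL (1 - \<nu> * (2 - \<mu>)) h \<longlongrightarrow> 0) (at_right a)"
    and ex: "phi_Hilfer_deriv_exists \<phi> \<phi>' a b 2 \<mu> \<nu> y"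
    and y: "\<And>t. t \<in> {a..b} \<Longrightarrow> y t = c * power_kernel \<xi> (\<phi> t - \<phi> a) + RL \<mu> h t"
    and t: "t \<in> {a<..b}"
  shows "phi_Hilfer_deriv \<phi> \<phi>' a b 2 \<mu> \<nu> y t = h t"
proof -
  define \<beta> where "\<beta> = (1 - \<nu>) * (2 - \<mu>)"
  define \<gamma> where "\<gamma> = \<nu> * (2 - \<mu>)"
  have "\<beta> \<le> 1 * (2 - \<mu>)" "\<gamma> \<le> 1 * (2 - \<mu>)"
    unfolding \<beta>_def \<gamma>_def using \<mu> \<nu> by (intro mult_right_mono; simp)+
  then have ord: "0 \<le> \<beta>" "\<beta> < 1" "0 \<le> \<gamma>" "\<gamma> < 1" "\<beta> + \<xi> = 2" "\<beta> + \<mu> = 1 + (1 - \<gamma>)" "1 < \<xi>"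
    using \<mu> \<nu> by (auto simp: \<beta>_def \<gamma>_def \<xi> algebra_simps add_pos_nonneg)
  define g where "g = phi_frac_integral \<phi> \<phi>' a \<beta> y"
  define f where "f = phi_deriv \<phi>' a b (phi_deriv \<phi>' a b g)"
  define w where "w = RL (1 - \<gamma>) h"
  note exD = Hilfer_existsD[OF ex, folded \<beta>_def \<gamma>_def, folded g_def, folded f_def]
  have ycont: "continuous_on {a..b} (\<lambda>t. c * power_kernel \<xi> (\<phi> t - \<phi> a) + RL \<mu> h t)"
    using ord h \<mu> by (intro continuous_intros continuous_on_kernel_phi continuous_on_RL) auto
  then have "continuous_on {a..b} y"
    by (rule continuous_on_eq) (rule y[symmetric])
  note ymeas = borel_measurable_integrable[OF integrable_continuous[OF this]]
    borel_measurable_integrable[OF integrable_continuous[OF ycont]]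
  have g: "g s = c * power_kernel 2 (\<phi> s - \<phi> a) + RL (1 + (1 - \<gamma>)) h s" if s: "s \<in> {a<..b}" for s
  proof (cases "\<beta> = 0")
    case True
    then show ?thesis using y[of s] s ord by (simp add: g_def)
  next
    case False
    then have \<beta>: "0 < \<beta>" using ord by simp
    then have "g s = RL \<beta> y s" using s by (simp add: g_def phi_frac_integral_eq)
    also have "\<dots> = RL \<beta> (\<lambda>t. c * power_kernel \<xi> (\<phi> t - \<phi> a) + RL \<mu> h t) s"
      using y ymeas by (intro RL_cong) auto
    also have "\<dots> = c * power_kernel (\<beta> + \<xi>) (\<phi> s - \<phi> a) + RL (\<beta> + \<mu>) h s"
      using \<beta> ord \<mu> h s by (intro RL_general_solution) auto
    finally show ?thesis by (simp only: ord)
  qed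
  have D1: "phi_deriv \<phi>' a b g s = c + w s" if s: "s \<in> {a<..b}" for s
  proof -
    have "(\<phi> has_real_derivative \<phi>' s) (at s within {a<..b})"
      using s by (intro has_field_derivative_subset[OF phi_deriv]) auto
    from DERIV_diff[OF exD(1)[OF s] DERIV_cmult[OF DERIV_diff[OF this DERIV_const[of "\<phi> a"]], of c]]
    have "((\<lambda>t. g t - c * (\<phi> t - \<phi> a)) has_real_derivative \<phi>' s * phi_deriv \<phi>' a b g s - c * \<phi>' s) (at s within {a<..b})"
      by simp
    then have "(RL (1 + (1 - \<gamma>)) h has_real_derivative \<phi>' s * phi_deriv \<phi>' a b g s - c * \<phi>' s) (at s within {a<..b})"
    proof (rule has_field_derivative_transform_within[OF _ zero_less_one s])
      fix t assume "t \<in> {a<..b}"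
      then show "g t - c * (\<phi> t - \<phi> a) = RL (1 + (1 - \<gamma>)) h t"
        using phi_ge[of t] by (simp add: g power_kernel_two)
    qed
    \<comment> \<open>The derivative is known to exist, so \<open>RL_derivative_eq\<close> with
      order 1 - \<gamma> yields its value.\<close>
    then have "\<phi>' s * phi_deriv \<phi>' a b g s - c * \<phi>' s = \<phi>' s * w s"
      unfolding w_def using ord(3,4) s h
      by (intro RL_derivative_eq[OF _ _ s] RL_exists_continuous_open) simp_all
    then have "\<phi>' s * phi_deriv \<phi>' a b g s = \<phi>' s * (c + w s)" by (simp add: algebra_simps)
    then show ?thesis using phi'_pos[of s] s by auto
  qed
  have w': "(w has_real_derivative \<phi>' s * f s) (at s within {a<..b})" if s: "s \<in> {a<..b}" for s
  proof -
    have "((\<lambda>t. phi_deriv \<phi>' a b g t - c) has_real_derivative \<phi>' s * f s) (at s within {a<..b})"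
      using DERIV_diff[OF exD(2)[OF s] DERIV_const[of c]] by simp
    then show ?thesis
      by (rule has_field_derivative_transform_within[OF _ zero_less_one s]) (simp add: D1)
  qed
  have h1: "(RL 1 h has_real_derivative \<phi>' t * h t) (at t within {a<..b})"
    using h t by (intro RL_one_has_derivative)
  have "phi_frac_integral \<phi> \<phi>' a \<gamma> f t = h t"
  proof (cases "\<gamma> = 0")
    \<comment> \<open>Here w is the integral of order 1 of h, and continuity of h lets it be
      differentiated directly.\<close>
    case True
    then have "f t = h t"
      using phi_deriv_eq[OF t w'[OF t]] phi_deriv_eq[OF t h1] by (simp add: w_def)
    then show ?thesis using True by simp
  next
    case False
    then have \<gamma>: "0 < \<gamma>" using ord by simp
    then have ei: "RL_exists \<gamma> f t" if "t \<in> {a<..b}" for t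
      using exD(3)[OF that] that by (simp add: phi_frac_integral_exists_iff)
    then have f: "integrable M f"
      using RL_exists_imp_integrable_le_1[OF \<gamma> _ ei] ord(4) a_less_b by simp
    obtain d where d: "\<And>s. s \<in> {a<..b} \<Longrightarrow> w s = d + RL 1 f s"
      using antiderivative_RL_one[OF f w'] by blast
    \<comment> \<open>Both terms tend to 0 at a, the first by hypothesis, so d vanishes. A nonzero d
      would leave an extra multiple of the kernel of order 1 + \<gamma> in the identity between the
      integrals of f and h.\<close>
    have "((\<lambda>s. w s - RL 1 f s) \<longlongrightarrow> 0 - 0) (at_right a)"
      using lim by (intro tendsto_diff RL_tendsto_0 f) (auto simp: w_def \<gamma>_def)
    moreover have "\<forall>\<^sub>F s in at_right a. w s - RL 1 f s = d"
      using a_less_b d by (intro eventually_at_rightI[of a b]) auto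
    ultimately have "((\<lambda>_. d) \<longlongrightarrow> 0) (at_right a)"
      using Lim_transform_eventually[of "\<lambda>s. w s - RL 1 f s" "0 - 0" "at_right a" "\<lambda>_. d"] by simp
    then have "d = 0" by (simp add: tendsto_const_iff)
    then have w: "w s = RL 1 f s" if "s \<in> {a<..b}" for s using d[OF that] by simp
    have "RL (1 + \<gamma>) f s = RL 1 h s" if s: "s \<in> {a..b}" for s
    proof -
      have "RL 1 h s = RL \<gamma> w s"
        unfolding w_def using RL_RL_integrable[of \<gamma> "1 - \<gamma>" s h] s \<gamma> ord(4) h(1) by simp
      also have "\<dots> = RL \<gamma> (RL 1 f) s"
      proof (rule RL_cong)
        show "w \<in> borel_measurable M" unfolding w_def using h(1) by measurable
      qed (use f w in measurable)
      also have "\<dots> = RL (1 + \<gamma>) f s"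
        using RL_RL_integrable[of \<gamma> 1 s f] s \<gamma> f by (simp add: add.commute)
      finally show ?thesis by simp
    qed
    \<comment> \<open>Continuity of h gives this derivative at every point t, so
      \<open>RL_derivative_eq\<close> yields equality at each point rather than almost
      everywhere.\<close>
    then have "(RL (1 + \<gamma>) f has_real_derivative \<phi>' t * h t) (at t within {a<..b})"
      by (intro has_field_derivative_transform_within[OF h1 zero_less_one t]) simp
    then have "\<phi>' t * h t = \<phi>' t * RL \<gamma> f t"
      using RL_derivative_eq[OF \<gamma> _ t f ei[OF t]] ord(4) by simp
    then show ?thesis using \<gamma> t phi'_pos[of t] by (simp add: phi_frac_integral_eq)
  qed
  then show ?thesis by (simp add: phi_Hilfer_deriv_2 f_def g_def \<beta>_def \<gamma>_def)
qed

section \<open>The nonlocal boundary condition\<close>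

lemma boundary_value_iff:
  assumes "1 < \<xi>" "1 < \<mu>" and h: "integrable M h"
    and y: "\<And>t. t \<in> {a..b} \<Longrightarrow> y t = c * power_kernel \<xi> (\<phi> t - \<phi> a) + RL \<mu> h t"
    and \<delta>: "\<And>i. i \<in> {1..m} \<Longrightarrow> 0 < \<delta> i" and \<tau>: "\<And>i. i \<in> {1..m} \<Longrightarrow> \<tau> i \<in> {a..b}"
    and \<Lambda>: "\<Lambda> = (\<phi> b - \<phi> a) powr (\<xi> - 1) / Gamma \<xi>
             - (\<Sum>i=1..m. lam i / Gamma (\<xi> + \<delta> i) * (\<phi> (\<tau> i) - \<phi> a) powr (\<xi> + \<delta> i - 1))"
  shows "y b = (\<Sum>i=1..m. lam i * phi_frac_integral \<phi> \<phi>' a (\<delta> i) y (\<tau> i)) \<longleftrightarrow>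
    c * \<Lambda> = (\<Sum>i=1..m. lam i * phi_frac_integral \<phi> \<phi>' a (\<mu> + \<delta> i) h (\<tau> i)) - phi_frac_integral \<phi> \<phi>' a \<mu> h b"
proof -
  have ycont: "continuous_on {a..b} (\<lambda>t. c * power_kernel \<xi> (\<phi> t - \<phi> a) + RL \<mu> h t)"
    using assms(1-3) by (intro continuous_intros continuous_on_kernel_phi continuous_on_RL) auto
  then have "continuous_on {a..b} y"
    by (rule continuous_on_eq) (rule y[symmetric])
  note ymeas = borel_measurable_integrable[OF integrable_continuous[OF this]]
    borel_measurable_integrable[OF integrable_continuous[OF ycont]]
  \<comment> \<open>The integral of order \<open>\<delta> i\<close> acts on the solution form term
    by term. The coefficients of c collected here and in y(b) combine to \<Lambda>, so the boundary
    condition is a linear equation for c.\<close>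
  have *: "lam i * phi_frac_integral \<phi> \<phi>' a (\<delta> i) y (\<tau> i)
      = c * (lam i / Gamma (\<xi> + \<delta> i) * (\<phi> (\<tau> i) - \<phi> a) powr (\<xi> + \<delta> i - 1))
        + lam i * phi_frac_integral \<phi> \<phi>' a (\<mu> + \<delta> i) h (\<tau> i)" if i: "i \<in> {1..m}" for i
  proof -
    have "phi_frac_integral \<phi> \<phi>' a (\<delta> i) y (\<tau> i)
        = RL (\<delta> i) (\<lambda>t. c * power_kernel \<xi> (\<phi> t - \<phi> a) + RL \<mu> h t) (\<tau> i)"
      using \<delta>[OF i] \<tau>[OF i] y ymeas unfolding phi_frac_integral_eq[OF \<delta>[OF i] \<tau>[OF i]]
      by (intro RL_cong) auto
    also have "\<dots> = c * power_kernel (\<delta> i + \<xi>) (\<phi> (\<tau> i) - \<phi> a) + RL (\<delta> i + \<mu>) h (\<tau> i)"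
      using \<delta>[OF i] \<tau>[OF i] assms(1-3) by (intro RL_general_solution) auto
    also have "RL (\<delta> i + \<mu>) h (\<tau> i) = phi_frac_integral \<phi> \<phi>' a (\<mu> + \<delta> i) h (\<tau> i)"
      using \<delta>[OF i] \<tau>[OF i] assms(2) by (simp add: phi_frac_integral_eq add.commute)
    finally show ?thesis
      using phi_ge[OF \<tau>[OF i]] by (simp add: power_kernel_eq_powr algebra_simps)
  qed
  have "y b = c * ((\<phi> b - \<phi> a) powr (\<xi> - 1) / Gamma \<xi>) + phi_frac_integral \<phi> \<phi>' a \<mu> h b"
    using y[of b] a_less_b phi_ge[of b] assms(2) by (simp add: power_kernel_eq_powr phi_frac_integral_eq)
  moreover have "(\<Sum>i=1..m. lam i * phi_frac_integral \<phi> \<phi>' a (\<delta> i) y (\<tau> i))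
      = c * (\<Sum>i=1..m. lam i / Gamma (\<xi> + \<delta> i) * (\<phi> (\<tau> i) - \<phi> a) powr (\<xi> + \<delta> i - 1))
        + (\<Sum>i=1..m. lam i * phi_frac_integral \<phi> \<phi>' a (\<mu> + \<delta> i) h (\<tau> i))"
    unfolding sum_distrib_left sum.distrib[symmetric] using * by (rule sum.cong[OF refl])
  moreover have "z = u \<longleftrightarrow> c * (p - q) = v - r" if "z = c * p + r" "u = c * q + v" for z u p q r v :: real
    using that by (auto simp: algebra_simps)
  ultimately show ?thesis
    unfolding \<Lambda> by blast
qed

end

section \<open>Positivity of the derivative of \<phi>, and the equivalence\<close>

lemma mono_on_imp_deriv_pos:
  fixes \<phi> :: "real \<Rightarrow> real"
  assumes "a < b"
    and deriv: "\<And>t. t \<in> {a..b} \<Longrightarrow> (\<phi> has_real_derivative \<phi>' t) (at t within {a..b})"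
    and mono: "mono_on {a..b} \<phi>" and nz: "\<And>t. t \<in> {a..b} \<Longrightarrow> \<phi>' t \<noteq> 0"
    and t: "t \<in> {a..b}"
  shows "0 < \<phi>' t"
proof -
  have "0 \<le> \<phi>' t"
  proof (rule tendsto_lowerbound)
    show "((\<lambda>y. (\<phi> y - \<phi> t) / (y - t)) \<longlongrightarrow> \<phi>' t) (at t within {a..b})"
      using deriv[OF t] by (simp add: has_field_derivative_iff)
    show "\<forall>\<^sub>F y in at t within {a..b}. 0 \<le> (\<phi> y - \<phi> t) / (y - t)"
      unfolding eventually_at_filter
    proof (intro always_eventually allI impI)
      fix y assume "y \<noteq> t" "y \<in> {a..b}"
      then show "0 \<le> (\<phi> y - \<phi> t) / (y - t)"
        using mono_onD[OF mono, of y t] mono_onD[OF mono, of t y] t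
        by (cases "y < t") (auto simp: zero_le_divide_iff)
    qed
    show "at t within {a..b} \<noteq> bot"
      using t assms(1) by (simp add: trivial_limit_within)
  qed
  then show ?thesis using nz[OF t] by simp
qed

theorem theorem3p1:
  fixes a b \<mu> \<nu> \<xi> \<Lambda> :: real
    and \<phi> \<phi>' h y :: "real \<Rightarrow> real"
    and m :: nat
    and lam \<delta> \<tau> :: "nat \<Rightarrow> real"
  assumes "0 \<le> a" and "a < b"
    and "\<And>t. t \<in> {a..b} \<Longrightarrow> (\<phi> has_real_derivative \<phi>' t) (at t within {a..b})"
    and "continuous_on {a..b} \<phi>'"
    and "mono_on {a..b} \<phi>"
    and "\<And>t. t \<in> {a..b} \<Longrightarrow> \<phi>' t \<noteq> 0"
    and "1 < \<mu>" and "\<mu> < 2" and "0 \<le> \<nu>" and "\<nu> \<le> 1"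
    and "\<xi> = \<mu> + \<nu> * (2 - \<mu>)"
    and "continuous_on {a<..b} h"
    \<comment> \<open>the fractional integral of h of order \<open>\<mu>\<close> exists\<close>
    and "\<And>t. t \<in> {a..b} \<Longrightarrow> phi_frac_integral_exists \<phi> \<phi>' a \<mu> h t"
    \<comment> \<open>not automatic for \<open>\<nu> > 0\<close> and h singular at a; the equivalence fails without it\<close>
    and "((phi_frac_integral \<phi> \<phi>' a (1 - \<nu> * (2 - \<mu>)) h) \<longlongrightarrow> 0) (at_right a)"
    and "1 \<le> m"
    and "\<And>i. i \<in> {1..m} \<Longrightarrow> 0 < \<delta> i"
    and "a \<le> \<tau> 1" and "strict_mono_on {1..m} \<tau>" and "\<tau> m \<le> b"
    and "\<Lambda> = (\<phi> b - \<phi> a) powr (\<xi> - 1) / Gamma \<xi>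
             - (\<Sum>i=1..m. lam i / Gamma (\<xi> + \<delta> i) * (\<phi> (\<tau> i) - \<phi> a) powr (\<xi> + \<delta> i - 1))"
    and "\<Lambda> \<noteq> 0"
    \<comment> \<open>y is a function for which the Hilfer derivative is defined\<close>
    and "phi_Hilfer_deriv_exists \<phi> \<phi>' a b 2 \<mu> \<nu> y"
  shows "nonlocal_bvp_solution \<phi> \<phi>' a b \<mu> \<nu> h m lam \<delta> \<tau> y \<longleftrightarrow>
    (\<forall>t\<in>{a..b}. y t =
       (\<phi> t - \<phi> a) powr (\<xi> - 1) / (\<Lambda> * Gamma \<xi>) *
         ((\<Sum>i=1..m. lam i * phi_frac_integral \<phi> \<phi>' a (\<mu> + \<delta> i) h (\<tau> i))
           - phi_frac_integral \<phi> \<phi>' a \<mu> h b)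
       + phi_frac_integral \<phi> \<phi>' a \<mu> h t)"
proof -
  interpret phi_interval a b \<phi> \<phi>'
    using assms(2-4) mono_on_imp_deriv_pos[OF assms(2,3,5,6)] by unfold_locales
  define S where "S = (\<Sum>i=1..m. lam i * phi_frac_integral \<phi> \<phi>' a (\<mu> + \<delta> i) h (\<tau> i))
           - phi_frac_integral \<phi> \<phi>' a \<mu> h b"
  have "0 \<le> \<nu> * (2 - \<mu>)" "\<nu> * (2 - \<mu>) \<le> 1 * (2 - \<mu>)"
    using assms(7-10) by (auto intro!: mult_right_mono)
  then have \<gamma>: "\<nu> * (2 - \<mu>) < 1" and \<xi>: "1 < \<xi>"
    using assms(7,11) by auto
  have \<tau>: "\<tau> i \<in> {a..b}" if "i \<in> {1..m}" for i
  proof -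
    have "\<tau> 1 \<le> \<tau> i"
      using that strict_mono_onD[OF assms(18), of 1 i] by (cases "i = 1") auto
    moreover have "\<tau> i \<le> \<tau> m"
      using that strict_mono_onD[OF assms(18), of i m] by (cases "i = m") auto
    ultimately show ?thesis using assms(17,19) by simp
  qed
  \<comment> \<open>The kernel of order \<mu> > 1 vanishes at s = b, so the integral alone does not
    control h near b; continuity of h on (a,b] closes the gap.\<close>
  have h: "integrable M h"
    using assms(2,7) assms(13)[of b] phi_frac_integral_exists_iff[of \<mu> b h]
    by (intro RL_exists_imp_integrable_continuous[OF _ _ assms(12) refl, of \<mu>]) simp_all
  have lim: "(RL (1 - \<nu> * (2 - \<mu>)) h \<longlongrightarrow> 0) (at_right a)"
    using assms(14)
  proof (rule Lim_transform_eventually)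
    show "\<forall>\<^sub>F t in at_right a. phi_frac_integral \<phi> \<phi>' a (1 - \<nu> * (2 - \<mu>)) h t = RL (1 - \<nu> * (2 - \<mu>)) h t"
      using assms(2) \<gamma> by (intro eventually_at_rightI[of a b]) (auto simp: phi_frac_integral_eq)
  qed
  \<comment> \<open>The integral equation is the solution form with the constant c = S / \<Lambda>,
    the value that the boundary condition dictates.\<close>
  have form: "(\<phi> t - \<phi> a) powr (\<xi> - 1) / (\<Lambda> * Gamma \<xi>) * S + phi_frac_integral \<phi> \<phi>' a \<mu> h t
      = S / \<Lambda> * power_kernel \<xi> (\<phi> t - \<phi> a) + RL \<mu> h t" if "t \<in> {a..b}" for t
    using assms(7) phi_ge[OF that] phi_frac_integral_eq[OF _ that, of \<mu> h]
    by (simp add: power_kernel_eq_powr)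
  note bv = boundary_value_iff[OF \<xi> assms(7) h _ assms(16) \<tau> assms(20), folded S_def]
  show ?thesis
    unfolding S_def[symmetric]
  proof
    assume sol: "nonlocal_bvp_solution \<phi> \<phi>' a b \<mu> \<nu> h m lam \<delta> \<tau> y"
    then have "phi_Hilfer_deriv \<phi> \<phi>' a b 2 \<mu> \<nu> y t = h t" if "t \<in> {a<..b}" for t
      using that by (simp add: nonlocal_bvp_solution_def)
    moreover have "continuous_on {a..b} y" "y a = 0"
      using sol by (simp_all add: nonlocal_bvp_solution_def)
    ultimately have "\<exists>c. \<forall>t\<in>{a..b}. y t = c * power_kernel \<xi> (\<phi> t - \<phi> a) + RL \<mu> h t"
      by (rule Hilfer_solution_form[OF assms(7-11) h assms(22)])
    then obtain c where c: "\<And>t. t \<in> {a..b} \<Longrightarrow> y t = c * power_kernel \<xi> (\<phi> t - \<phi> a) + RL \<mu> h t"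
      by blast
    have "c * \<Lambda> = S"
      using bv[OF c] sol unfolding nonlocal_bvp_solution_def by simp
    then have "c = S / \<Lambda>" using assms(21) by (simp add: field_simps)
    then show "\<forall>t\<in>{a..b}. y t = (\<phi> t - \<phi> a) powr (\<xi> - 1) / (\<Lambda> * Gamma \<xi>) * S
        + phi_frac_integral \<phi> \<phi>' a \<mu> h t"
      using c form by simp
  next
    assume "\<forall>t\<in>{a..b}. y t = (\<phi> t - \<phi> a) powr (\<xi> - 1) / (\<Lambda> * Gamma \<xi>) * S
        + phi_frac_integral \<phi> \<phi>' a \<mu> h t"
    then have y: "y t = S / \<Lambda> * power_kernel \<xi> (\<phi> t - \<phi> a) + RL \<mu> h t" if "t \<in> {a..b}" for t
      using that form by simp
    have "continuous_on {a..b} (\<lambda>t. S / \<Lambda> * power_kernel \<xi> (\<phi> t - \<phi> a) + RL \<mu> h t)"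
      using \<xi> h assms(7) by (intro continuous_intros continuous_on_kernel_phi continuous_on_RL) auto
    then have "continuous_on {a..b} y"
      by (rule continuous_on_eq) (rule y[symmetric])
    moreover have "y a = 0" using y[of a] assms(2) by simp
    moreover have "\<forall>t\<in>{a<..b}. phi_Hilfer_deriv \<phi> \<phi>' a b 2 \<mu> \<nu> y t = h t"
      by (intro ballI Hilfer_deriv_solution[OF assms(7-11) h assms(12) lim assms(22) y])
    moreover have "y b = (\<Sum>i=1..m. lam i * phi_frac_integral \<phi> \<phi>' a (\<delta> i) y (\<tau> i))"
      using bv[OF y] assms(21) by simp
    ultimately show "nonlocal_bvp_solution \<phi> \<phi>' a b \<mu> \<nu> h m lam \<delta> \<tau> y"
      unfolding nonlocal_bvp_solution_def using assms(22) by blast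
  qed
qed

end
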